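(* For any non-decreasing $L$-Lipschitz $u:\mathbb{R}\to[0,1]$ and any function $P:\{-1,1\}^n\to\mathbb{R}$ with $L_1(P)\le k$, given query access to $u\circ P$, KMtron run with $\lambda=\frac{\epsilon}{2L}$, $T=\frac{2k^2L^2}{\epsilon^2}$ and $\theta\le\frac{C'\epsilon^4}{L^4k^3}$ for a sufficiently small constant $C'>0$ outputs $P^*$ such that $\mathbb{E}_{x\in\{-1,1\}^n}[(u(P(x))-u(P^*(x)))^2]\le\epsilon$, where $x$ is uniform on $\{-1,1\}^n$. The running time of KMtron is $\mathrm{poly}(n,k,L,1/\epsilon)$.
   Context: For $P:\{-1,1\}^n\to\mathbb{R}$ with Fourier coefficients $\hat P(S)$, $S\subseteq[n]$, let $L_1(P)=\sum_S|\hat P(S)|$, $L_2(P)=(\sum_S\hat P(S)^2)^{1/2}$, $L_\infty(P)=\max_S|\hat P(S)|$, $\mathrm{supp}(P)$ the set of $S$ with $\hat P(S)\ne0$, and $\|P\|_2=(\mathbb{E}_x[P(x)^2])^{1/2}$ with $x$ uniform. Let $K=\{Q:\{-1,1\}^n\to\mathbb{R}\mid L_1(Q)\le k\}$ and $\mathrm{proj}_K(P)=\arg\min_{Q\in K}\|Q-P\|_2$. $\mathsf{KM}(Q,\theta)$ denotes the Kushilevitz–Mansour algorithm: given oracle access to $Q$, it returns $Q'$ with $|\mathrm{supp}(Q')|\le O(L_2(Q)^2\theta^{-2})$ and $L_\infty(Q-Q')\le\theta$, in time $\mathrm{poly}(n,\theta^{-1},L_2(Q))$. KMtron: input $u$,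 query access to $u\circ P$, learning rate $\lambda\in(0,1]$, iterations $T$, error parameter $\theta$. Set $P_0=0$; for $t=1,\dots,T$: $P_t'=P_{t-1}+\lambda\,\mathsf{KM}(u\circ P-u\circ P_{t-1},\theta)$ and $P_t=\mathsf{KM}(\mathrm{proj}_K(P_t'),\theta)$. Output $P^*=P_t$ for the best iterate $t\in\{1,\dots,T\}$ (the one with smallest $\mathbb{E}_x[(u(P(x))-u(P_t(x)))^2]$).
   Formalization: KM is randomized, given an upper bound on L_2(Q), and reports only S with |Q^(S)| at least a constant times θ; the error bound holds with probability 1-δ, time also polynomial in ln(1/δ) (and 1/θ if θ is below its bound); the best iterate is exact or chosen by samples. *)

theory Defs
  imports "HOL-Probability.Probability"
begin

section \<open>Fourier analysis on the cube\<close>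

text \<open>
  The dimension \<open>n\<close> must be a variable inside formulas (running times are polynomial in it), so a
  function on the cube is a HOL function on all of \<open>nat \<Rightarrow> real\<close>. Every notion in this section
  depends only on its values on \<open>cube n\<close>.
\<close>

type_synonym point = "nat \<Rightarrow> real"

definition cube :: "nat \<Rightarrow> point set" where
  "cube n = {1..n} \<rightarrow>\<^sub>E {-1, 1}"

definition expect :: "nat \<Rightarrow> (point \<Rightarrow> real) \<Rightarrow> real" where
  "expect n f = measure_pmf.expectation (pmf_of_set (cube n)) f"

definition fourier :: "nat \<Rightarrow> (point \<Rightarrow> real) \<Rightarrow> nat set \<Rightarrow> real" where
  "fourier n P S = expect n (\<lambda>x. P x * (\<Prod>i\<in>S. x i))"

definition supp :: "nat \<Rightarrow> (point \<Rightarrow> real) \<Rightarrow> nat set set" where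
  "supp n P = {S \<in> Pow {1..n}. fourier n P S \<noteq> 0}"

definition L1 :: "nat \<Rightarrow> (point \<Rightarrow> real) \<Rightarrow> real" where
  "L1 n P = (\<Sum>S\<in>Pow {1..n}. \<bar>fourier n P S\<bar>)"

definition L2 :: "nat \<Rightarrow> (point \<Rightarrow> real) \<Rightarrow> real" where
  "L2 n P = sqrt (\<Sum>S\<in>Pow {1..n}. (fourier n P S)\<^sup>2)"

definition Linf :: "nat \<Rightarrow> (point \<Rightarrow> real) \<Rightarrow> real" where
  "Linf n P = Max ((\<lambda>S. \<bar>fourier n P S\<bar>) ` Pow {1..n})"

definition norm2 :: "nat \<Rightarrow> (point \<Rightarrow> real) \<Rightarrow> real" where
  "norm2 n P = sqrt (expect n (\<lambda>x. (P x)\<^sup>2))"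

definition L1_ball :: "nat \<Rightarrow> real \<Rightarrow> (point \<Rightarrow> real) set" where
  "L1_ball n k = {Q. L1 n Q \<le> k}"

text \<open>The minimiser is unique on \<open>cube n\<close>; its values elsewhere are unspecified.\<close>

definition proj_K :: "nat \<Rightarrow> real \<Rightarrow> (point \<Rightarrow> real) \<Rightarrow> (point \<Rightarrow> real)" where
  "proj_K n k P = arg_min_on (\<lambda>Q. norm2 n (\<lambda>x. Q x - P x)) (L1_ball n k)"

definition err :: "nat \<Rightarrow> (real \<Rightarrow> real) \<Rightarrow> (point \<Rightarrow> real) \<Rightarrow> (point \<Rightarrow> real) \<Rightarrow> real" where
  "err n u P F = expect n (\<lambda>x. (u (P x) - u (F x))\<^sup>2)"


section \<open>Randomised programs with oracle access\<close>

text \<open>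
  \<open>Query x c\<close> asks the oracle for its value at \<open>x\<close>, \<open>Flip c\<close> tosses a fair coin, and \<open>Spend m p\<close>
  accounts for \<open>m\<close> steps of local computation (exact real arithmetic, with evaluation of \<open>u\<close> at
  unit cost). Each query and each coin toss costs one step.
\<close>

datatype 'a prog =
    Return 'a
  | Query point "real \<Rightarrow> 'a prog"
  | Flip "bool \<Rightarrow> 'a prog"
  | Spend nat "'a prog"

primrec bind_prog :: "'a prog \<Rightarrow> ('a \<Rightarrow> 'b prog) \<Rightarrow> 'b prog" where
  "bind_prog (Return a) g = g a"
| "bind_prog (Query x c) g = Query x (\<lambda>r. bind_prog (c r) g)"
| "bind_prog (Flip c) g = Flip (\<lambda>b. bind_prog (c b) g)"
| "bind_prog (Spend m p) g = Spend m (bind_prog p g)"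

adhoc_overloading Monad_Syntax.bind \<rightleftharpoons> bind_prog

text \<open>Joint distribution of the result and the number of steps.\<close>

primrec run :: "(point \<Rightarrow> real) \<Rightarrow> 'a prog \<Rightarrow> ('a \<times> nat) pmf" where
  "run f (Return a) = return_pmf (a, 0)"
| "run f (Query x c) = map_pmf (apsnd Suc) (run f (c (f x)))"
| "run f (Flip c) = bind_pmf (bernoulli_pmf (1/2)) (\<lambda>b. map_pmf (apsnd Suc) (run f (c b)))"
| "run f (Spend m p) = map_pmf (apsnd ((+) m)) (run f p)"

text \<open>\<open>simulate h p\<close> answers every query \<open>x\<close> of \<open>p\<close> by running \<open>h x\<close> (at the cost of \<open>h x\<close>).\<close>

primrec simulate :: "(point \<Rightarrow> real prog) \<Rightarrow> 'a prog \<Rightarrow> 'a prog" where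
  "simulate h (Return a) = Return a"
| "simulate h (Query x c) = bind_prog (h x) (\<lambda>r. simulate h (c r))"
| "simulate h (Flip c) = Flip (\<lambda>b. simulate h (c b))"
| "simulate h (Spend m p) = Spend m (simulate h p)"

definition spend :: "nat \<Rightarrow> unit prog" where
  "spend m = Spend m (Return ())"

definition query :: "point \<Rightarrow> real prog" where
  "query x = Query x Return"

definition flip :: "bool prog" where
  "flip = Flip Return"


section \<open>The Kushilevitz--Mansour guarantee\<close>

text \<open>
  \<open>KM n B \<theta> \<delta>\<close> is a program with oracle access to a function \<open>Q\<close> on the \<open>n\<close>-dimensional cube, where
  \<open>B\<close> is an upper bound on \<open>L2 n Q\<close> and \<open>\<delta>\<close> bounds the failure probability. Both are inputs because
  the algorithm has to fix its sample sizes before it has seen the oracle.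

  The algorithm searches for the sets \<open>S\<close> with large coefficient and returns estimates for those.
  The clause \<open>\<gamma> * \<theta> \<le> \<bar>fourier n Q S\<bar>\<close> records that it reports no light set (classically
  \<open>\<gamma> = 1/2\<close>), which is the source of the bound on the support. The two consequences
  \<open>card (supp n Q') = O((L2 n Q)\<^sup>2 / \<theta>\<^sup>2)\<close> and \<open>Linf n (Q - Q') \<le> \<theta>\<close> by themselves also permit adding
  to \<open>Q\<close> a noise term with about \<open>(L2 n Q / \<theta>)\<^sup>2\<close> coefficients equal to \<open>\<theta>\<close>, whose 2-norm does not
  shrink with \<open>\<theta>\<close>.

  The output is written down as its list of nonzero coefficients, so the time bounds their number.
\<close>

type_synonym km_procedure = "nat \<Rightarrow> real \<Rightarrow> real \<Rightarrow> real \<Rightarrow> (point \<Rightarrow> real) prog"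

definition is_KM :: "km_procedure \<Rightarrow> bool" where
  "is_KM KM \<longleftrightarrow>
    (\<exists>(c::real) (\<gamma>::real) (a::real) (d::nat). \<gamma> > 0 \<and>
      (\<forall>n B \<theta> \<delta> Q. B > 0 \<longrightarrow> \<theta> > 0 \<longrightarrow> 0 < \<delta> \<longrightarrow> \<delta> < 1 \<longrightarrow> L2 n Q \<le> B \<longrightarrow>
        measure_pmf.prob (run Q (KM n B \<theta> \<delta>))
          {(Q', t). real (card (supp n Q')) \<le> c * (L2 n Q)\<^sup>2 / \<theta>\<^sup>2 \<and>
                    Linf n (\<lambda>x. Q x - Q' x) \<le> \<theta> \<and>
                    (\<forall>S\<in>supp n Q'. \<gamma> * \<theta> \<le> \<bar>fourier n Q S\<bar>)} \<ge> 1 - \<delta> \<and>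
        (\<forall>(Q', t)\<in>set_pmf (run Q (KM n B \<theta> \<delta>)).
           real t \<le> a * (1 + real n + 1/\<theta> + B + ln (1/\<delta>)) ^ d \<and> card (supp n Q') \<le> t)))"


section \<open>KMtron\<close>

definition eval_cost :: "nat \<Rightarrow> (point \<Rightarrow> real) \<Rightarrow> nat" where
  "eval_cost n F = (n + 1) * (1 + card (supp n F))"

text \<open>
  \<open>proj_K n k F\<close> soft-thresholds the coefficients of \<open>F\<close>; the threshold is found by sorting their
  absolute values, so a quadratic number of steps is ample.
\<close>

definition proj_cost :: "nat \<Rightarrow> (point \<Rightarrow> real) \<Rightarrow> nat" where
  "proj_cost n F = (n + 1) * (1 + card (supp n F))\<^sup>2"

text \<open>The oracles for \<open>u \<circ> P - u \<circ> F\<close> (given query access to \<open>u \<circ> P\<close>) and for a known \<open>F\<close>.\<close>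

definition residual_oracle :: "nat \<Rightarrow> (real \<Rightarrow> real) \<Rightarrow> (point \<Rightarrow> real) \<Rightarrow> point \<Rightarrow> real prog" where
  "residual_oracle n u F x = do {
     y \<leftarrow> query x;
     _ \<leftarrow> spend (eval_cost n F);
     Return (y - u (F x)) }"

definition explicit_oracle :: "nat \<Rightarrow> (point \<Rightarrow> real) \<Rightarrow> point \<Rightarrow> real prog" where
  "explicit_oracle n F x = do { _ \<leftarrow> spend (eval_cost n F); Return (F x) }"

text \<open>
  The \<open>L2\<close> bounds passed to \<open>KM\<close> are \<open>1\<close> for a difference of two functions into \<open>[0,1]\<close>, and \<open>k\<close> for
  an element of the ball.
\<close>

definition kmtron_step ::
  "km_procedure \<Rightarrow> nat \<Rightarrow> (real \<Rightarrow> real) \<Rightarrow> real \<Rightarrow> real \<Rightarrow> real \<Rightarrow> real \<Rightarrow> (point \<Rightarrow> real) \<Rightarrow> (point \<Rightarrow> real) prog"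
where
  "kmtron_step KM n u k lr \<theta> \<delta> F = do {
     R \<leftarrow> simulate (residual_oracle n u F) (KM n 1 \<theta> \<delta>);
     _ \<leftarrow> spend (eval_cost n F + eval_cost n R);
     let F' = (\<lambda>x. F x + lr * R x);
     _ \<leftarrow> spend (proj_cost n F');
     simulate (explicit_oracle n (proj_K n k F')) (KM n k \<theta> \<delta>) }"

text \<open>\<open>iterates \<dots> T F\<close> is the list of the \<open>T\<close> iterates that follow \<open>F\<close>.\<close>

primrec iterates ::
  "km_procedure \<Rightarrow> nat \<Rightarrow> (real \<Rightarrow> real) \<Rightarrow> real \<Rightarrow> real \<Rightarrow> real \<Rightarrow> real \<Rightarrow> nat \<Rightarrow> (point \<Rightarrow> real) \<Rightarrow>
   (point \<Rightarrow> real) list prog"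
where
  "iterates KM n u k lr \<theta> \<delta> 0 F = Return []"
| "iterates KM n u k lr \<theta> \<delta> (Suc T) F = do {
     F' \<leftarrow> kmtron_step KM n u k lr \<theta> \<delta> F;
     Fs \<leftarrow> iterates KM n u k lr \<theta> \<delta> T F';
     Return (F' # Fs) }"

primrec random_point :: "nat \<Rightarrow> point prog" where
  "random_point 0 = Return (\<lambda>_. undefined)"
| "random_point (Suc n) = do {
     b \<leftarrow> flip;
     x \<leftarrow> random_point n;
     Return (x(Suc n := if b then 1 else -1)) }"

primrec labelled_sample :: "nat \<Rightarrow> nat \<Rightarrow> (point \<times> real) list prog" where
  "labelled_sample n 0 = Return []"
| "labelled_sample n (Suc m) = do {
     x \<leftarrow> random_point n;
     y \<leftarrow> query x;
     zs \<leftarrow> labelled_sample n m;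
     Return ((x, y) # zs) }"

definition empirical_err :: "(real \<Rightarrow> real) \<Rightarrow> (point \<times> real) list \<Rightarrow> (point \<Rightarrow> real) \<Rightarrow> real" where
  "empirical_err u zs F = (\<Sum>(x, y)\<leftarrow>zs. (y - u (F x))\<^sup>2) / real (length zs)"

text \<open>
  \<open>KM\<close> is called with confidence parameter \<open>\<delta>\<close>. The best iterate minimises an average over all of
  the cube, which takes \<open>2 ^ n\<close> queries to compute exactly. The program therefore returns all
  iterates \<open>P\<^sub>1, \<dots>, P\<^sub>T\<close>, together with the one that is best on \<open>m\<close> fresh random points; the exact
  best iterate is \<open>best_iterate\<close> of the first component.
\<close>

definition kmtron ::
  "km_procedure \<Rightarrow> nat \<Rightarrow> (real \<Rightarrow> real) \<Rightarrow> real \<Rightarrow> real \<Rightarrow> nat \<Rightarrow> real \<Rightarrow> real \<Rightarrow> nat \<Rightarrow>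
   ((point \<Rightarrow> real) list \<times> (point \<Rightarrow> real)) prog"
where
  "kmtron KM n u k lr T \<theta> \<delta> m = do {
     Fs \<leftarrow> iterates KM n u k lr \<theta> \<delta> T (\<lambda>_. 0);
     zs \<leftarrow> labelled_sample n m;
     _ \<leftarrow> spend (\<Sum>F\<leftarrow>Fs. 1 + m * eval_cost n F);
     Return (Fs, arg_min_list (empirical_err u zs) Fs) }"

definition best_iterate ::
  "nat \<Rightarrow> (real \<Rightarrow> real) \<Rightarrow> (point \<Rightarrow> real) \<Rightarrow> (point \<Rightarrow> real) list \<Rightarrow> (point \<Rightarrow> real)"
where
  "best_iterate n u P Fs = arg_min_list (err n u P) Fs"

end

theory Submission
  imports Defs
begin

text \<open>
  Let \<open>g = u \<circ> P - u \<circ> F\<close> be the residual at the current iterate \<open>F\<close>. Monotonicity and the Lipschitz bound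
  make \<open>g\<close> correlate with \<open>P - F\<close>, so a gradient step along \<open>g\<close> decreases the squared distance to \<open>P\<close> by
  about \<open>(\<epsilon>/L)\<^sup>2\<close> as long as the error of \<open>F\<close> exceeds \<open>9/10 * \<epsilon>\<close>. The distance is at most \<open>k\<^sup>2\<close> at
  the start, so some iterate has smaller error. Both uses of \<open>KM\<close> perturb Fourier coefficients by at most
  \<open>\<theta>\<close>, and the perturbations are only paired with functions whose \<open>L1\<close> norm is \<open>O(k)\<close>. The slack
  \<open>\<epsilon>/10\<close> is spent on choosing the best iterate from samples, by Hoeffding's inequality.
\<close>

section \<open>Walsh expansion\<close>

text \<open>The second call of \<open>KM\<close> can leave the ball. The clause that
  \<open>KM\<close> reports no light set turns its additive error \<open>\<theta>\<close> into a
  relative one, so every iterate has \<open>L1\<close> norm at most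
  \<open>(1 + 1 / \<gamma>) * k\<close>. The next projection returns to the ball, so this factor
  does not compound. With \<open>q = (\<epsilon> / L)\<^sup>2\<close> and
  \<open>\<epsilon> < 1\<close>, the rate \<open>\<epsilon> / (2 * L)\<close> gains at least
  \<open>27/40 * q\<close> per step at error \<open>9/10 * \<epsilon>\<close>. The \<open>KM\<close>
  errors may take \<open>q / 10\<close> of this, and \<open>T\<close> steps of
  \<open>23/40 * q\<close> amount to \<open>23/20 * k\<^sup>2\<close>. The oracles are adaptive:
  each depends on earlier coin tosses. The guarantee of \<open>KM\<close> holds for every fixed
  oracle, so failure probabilities add along the run. Time is bounded on every outcome, also when
  \<open>KM\<close> fails; therefore the sparsity of the iterates is carried as a separate
  invariant.\<close>

definition walsh :: "nat set \<Rightarrow> point \<Rightarrow> real" where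
  "walsh S x = (\<Prod>i\<in>S. x i)"

lemma finite_cube [simp]: "finite (cube n)"
  unfolding cube_def by (intro finite_PiE) auto

lemma card_cube [simp]: "card (cube n) = 2 ^ n"
  unfolding cube_def by (subst card_PiE) (auto simp: numeral_2_eq_2)

lemma cube_nonempty [simp]: "cube n \<noteq> {}"
  by (metis card.empty card_cube power_not_zero zero_neq_numeral)

lemma expect_eq_sum: "expect n f = (\<Sum>x\<in>cube n. f x) / 2 ^ n"
  unfolding expect_def by (simp add: integral_pmf_of_set)

lemma expect_cong: "(\<And>x. x \<in> cube n \<Longrightarrow> f x = g x) \<Longrightarrow> expect n f = expect n g"
  unfolding expect_eq_sum by (simp cong: sum.cong)

lemma expect_mono: "(\<And>x. x \<in> cube n \<Longrightarrow> f x \<le> g x) \<Longrightarrow> expect n f \<le> expect n g"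
  unfolding expect_eq_sum by (intro divide_right_mono sum_mono) auto

lemma expect_add: "expect n (\<lambda>x. f x + g x) = expect n f + expect n g"
  unfolding expect_eq_sum by (simp add: sum.distrib add_divide_distrib)

lemma expect_diff: "expect n (\<lambda>x. f x - g x) = expect n f - expect n g"
  unfolding expect_eq_sum by (simp add: sum_subtractf diff_divide_distrib)

lemma expect_cmult: "expect n (\<lambda>x. c * f x) = c * expect n f"
  unfolding expect_eq_sum by (simp add: sum_distrib_left)

lemma expect_const [simp]: "expect n (\<lambda>_. c) = c"
  unfolding expect_eq_sum by simp

lemma expect_nonneg: "(\<And>x. x \<in> cube n \<Longrightarrow> 0 \<le> f x) \<Longrightarrow> 0 \<le> expect n f"
  using expect_mono[of n "\<lambda>_. 0" f] by simp

lemma fourier_walsh: "fourier n f S = expect n (\<lambda>x. f x * walsh S x)"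
  unfolding fourier_def walsh_def ..

lemma fourier_add: "fourier n (\<lambda>x. f x + g x) S = fourier n f S + fourier n g S"
  unfolding fourier_def by (simp add: distrib_right expect_add)

lemma fourier_diff: "fourier n (\<lambda>x. f x - g x) S = fourier n f S - fourier n g S"
  unfolding fourier_def by (simp add: left_diff_distrib expect_diff)

lemma fourier_cmult: "fourier n (\<lambda>x. c * f x) S = c * fourier n f S"
  unfolding fourier_def by (simp add: mult.assoc expect_cmult)

lemma fourier_zero [simp]: "fourier n (\<lambda>_. 0) S = 0"
  unfolding fourier_def by simp

lemmas fourier_linear = fourier_add fourier_diff fourier_cmult

text \<open>Expanding the product of the \<open>x i * y i + 1\<close> over subsets gives the sum; a
  coordinate where the points differ contributes the factor \<open>-1 + 1\<close>. This
  orthogonality in the points yields \<open>plancherel\<close> without expanding functions in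
  characters.\<close>

lemma sum_walsh_walsh:
  assumes "x \<in> cube n" "y \<in> cube n"
  shows "(\<Sum>S\<in>Pow {1..n}. walsh S x * walsh S y) = (if x = y then 2 ^ n else 0)"
proof -
  have "(\<Sum>S\<in>Pow {1..n}. walsh S x * walsh S y) = (\<Prod>i\<in>{1..n}. x i * y i + 1)"
    by (subst prod_add) (simp_all add: walsh_def prod.distrib)
  also have "\<dots> = (if x = y then 2 ^ n else 0)"
  proof (cases "x = y")
    case True
    have "x i * x i + 1 = 2" if "i \<in> {1..n}" for i
      using PiE_mem[OF assms(1)[unfolded cube_def] that] by auto
    then show ?thesis using True by simp
  next
    case False
    then obtain i where i: "i \<in> {1..n}" "x i \<noteq> y i"
      using assms PiE_ext[of x "{1..n}" "\<lambda>_. {-1, 1}" y] unfolding cube_def by blast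
    have "x i \<in> {-1, 1}" "y i \<in> {-1, 1}"
      using assms i unfolding cube_def by (blast dest: PiE_mem)+
    then have "x i * y i + 1 = 0" using i by auto
    then have "(\<Prod>i\<in>{1..n}. x i * y i + 1) = 0" using i by (intro prod_zero) auto
    then show ?thesis using False by simp
  qed
  finally show ?thesis .
qed

lemma plancherel:
  "expect n (\<lambda>x. f x * g x) = (\<Sum>S\<in>Pow {1..n}. fourier n f S * fourier n g S)"
proof -
  have "(\<Sum>S\<in>Pow {1..n}. fourier n f S * fourier n g S) =
      (\<Sum>S\<in>Pow {1..n}. \<Sum>x\<in>cube n. \<Sum>y\<in>cube n. f x * g y * (walsh S x * walsh S y)) / (2 ^ n * 2 ^ n)"
    unfolding fourier_walsh expect_eq_sum
    by (simp add: sum_product sum_divide_distrib algebra_simps)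
  also have "(\<Sum>S\<in>Pow {1..n}. \<Sum>x\<in>cube n. \<Sum>y\<in>cube n. f x * g y * (walsh S x * walsh S y)) =
      (\<Sum>x\<in>cube n. \<Sum>y\<in>cube n. \<Sum>S\<in>Pow {1..n}. f x * g y * (walsh S x * walsh S y))"
    by (subst sum.swap, rule sum.cong[OF refl], rule sum.swap)
  also have "\<dots> = (\<Sum>x\<in>cube n. \<Sum>y\<in>cube n. if x = y then f x * g y * 2 ^ n else 0)"
    by (intro sum.cong refl) (simp add: sum_walsh_walsh del: atLeastAtMost_iff flip: sum_distrib_left One_nat_def)
  also have "\<dots> = (\<Sum>x\<in>cube n. f x * g x * 2 ^ n)"
    by (simp add: sum.delta)
  also have "\<dots> / (2 ^ n * 2 ^ n) = expect n (\<lambda>x. f x * g x)"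
    unfolding expect_eq_sum by (simp flip: sum_distrib_right)
  finally show ?thesis ..
qed

lemma parseval: "expect n (\<lambda>x. (f x)\<^sup>2) = (\<Sum>S\<in>Pow {1..n}. (fourier n f S)\<^sup>2)"
  using plancherel[of n f f] by (simp add: power2_eq_square)

text \<open>Each character is padded with factors 1 to a product over all of \<open>{1..n}\<close>,
  so that the sum over the cube splits into a two-term sum per coordinate.\<close>

lemma expect_walsh_walsh:
  assumes "S \<subseteq> {1..n}" "T \<subseteq> {1..n}"
  shows "expect n (\<lambda>x. walsh S x * walsh T x) = (if S = T then 1 else 0)"
proof -
  define h where "h i b = (if i \<in> S then b else 1) * (if i \<in> T then b else (1::real))" for i b
  have "walsh S x * walsh T x = (\<Prod>i\<in>{1..n}. h i (x i))" for x
  proof -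
    have "walsh S x = (\<Prod>i\<in>{1..n}. if i \<in> S then x i else 1)"
      using assms(1) by (simp add: walsh_def prod.If_cases Int_absorb1)
    moreover have "walsh T x = (\<Prod>i\<in>{1..n}. if i \<in> T then x i else 1)"
      using assms(2) by (simp add: walsh_def prod.If_cases Int_absorb1)
    ultimately show ?thesis by (simp add: h_def prod.distrib)
  qed
  then have "expect n (\<lambda>x. walsh S x * walsh T x) =
      (\<Sum>x\<in>cube n. \<Prod>i\<in>{1..n}. h i (x i)) / 2 ^ n"
    unfolding expect_eq_sum by simp
  also have "(\<Sum>x\<in>cube n. \<Prod>i\<in>{1..n}. h i (x i)) = (\<Prod>i\<in>{1..n}. \<Sum>b\<in>{-1, 1}. h i b)"
    unfolding cube_def by (rule prod_sum_PiE[symmetric]) auto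
  also have "\<dots> = (\<Prod>i\<in>{1..n}. if i \<in> S \<longleftrightarrow> i \<in> T then 2 else 0)"
    by (intro prod.cong refl) (auto simp: h_def)
  also have "\<dots> / 2 ^ n = (if S = T then 1 else 0)"
  proof (cases "S = T")
    case False
    then obtain i where "\<not> (i \<in> S \<longleftrightarrow> i \<in> T)" by blast
    with assms have "i \<in> {1..n}" "\<not> (i \<in> S \<longleftrightarrow> i \<in> T)" by blast+
    then have "(\<Prod>i\<in>{1..n}. if i \<in> S \<longleftrightarrow> i \<in> T then 2 else (0::real)) = 0"
      by (intro prod_zero) auto
    then show ?thesis using False by simp
  qed simp
  finally show ?thesis .
qed

text \<open>Realises any coefficient vector. The minimiser in \<open>ex_projection\<close> and the
  competitor in \<open>supp_proj_K\<close> are built this way.\<close>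

lemma fourier_synthesis:
  assumes "S \<subseteq> {1..n}"
  shows "fourier n (\<lambda>x. \<Sum>T\<in>Pow {1..n}. c T * walsh T x) S = c S"
proof -
  have "fourier n (\<lambda>x. \<Sum>T\<in>Pow {1..n}. c T * walsh T x) S =
      (\<Sum>T\<in>Pow {1..n}. c T * expect n (\<lambda>x. walsh T x * walsh S x))"
    unfolding fourier_walsh expect_eq_sum
    by (simp add: sum_distrib_right sum_distrib_left sum_divide_distrib mult.assoc)
       (rule sum.swap)
  also have "\<dots> = (\<Sum>T\<in>Pow {1..n}. if T = S then c T else 0)"
    using assms by (intro sum.cong refl) (auto simp: expect_walsh_walsh)
  also have "\<dots> = c S" using assms by (subst sum.delta) auto
  finally show ?thesis .
qed

lemma supp_subset_Pow: "supp n f \<subseteq> Pow {1..n}"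
  unfolding supp_def by auto

lemma finite_supp [simp]: "finite (supp n f)"
  using supp_subset_Pow by (rule finite_subset) simp

lemma supp_zero [simp]: "supp n (\<lambda>_. 0) = {}"
  unfolding supp_def by simp

lemma supp_add_cmult: "supp n (\<lambda>x. f x + c * g x) \<subseteq> supp n f \<union> supp n g"
  unfolding supp_def by (auto simp: fourier_linear)

lemma fourier_le_Linf: "S \<subseteq> {1..n} \<Longrightarrow> \<bar>fourier n f S\<bar> \<le> Linf n f"
  unfolding Linf_def by (intro Max_ge) auto

lemma L1_add: "L1 n (\<lambda>x. f x + g x) \<le> L1 n f + L1 n g"
  unfolding L1_def by (simp add: fourier_add sum_mono flip: sum.distrib)

lemma L1_diff: "L1 n (\<lambda>x. f x - g x) \<le> L1 n f + L1 n g"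
  unfolding L1_def by (simp add: fourier_diff sum_mono flip: sum.distrib)

lemma L1_cmult: "L1 n (\<lambda>x. c * f x) = \<bar>c\<bar> * L1 n f"
  unfolding L1_def by (simp add: fourier_cmult abs_mult sum_distrib_left)

lemma L2_squared: "(L2 n f)\<^sup>2 = expect n (\<lambda>x. (f x)\<^sup>2)"
  unfolding L2_def parseval by (simp add: sum_nonneg)

lemma L2_nonneg: "0 \<le> L2 n f"
  unfolding L2_def by (simp add: sum_nonneg)

lemma L2_le_L1: "L2 n f \<le> L1 n f"
  unfolding L1_def L2_def by (rule L2_set_le_sum_abs[unfolded L2_set_def])

text \<open>Hoelder's inequality on the Fourier side. \<open>KM\<close> controls only the largest
  coefficient of its error, so every error term is brought to this form.\<close>

lemma expect_mult_le:
  assumes "Linf n f \<le> b"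
  shows "\<bar>expect n (\<lambda>x. f x * g x)\<bar> \<le> b * L1 n g"
proof -
  have "\<bar>expect n (\<lambda>x. f x * g x)\<bar> \<le> (\<Sum>S\<in>Pow {1..n}. \<bar>fourier n f S * fourier n g S\<bar>)"
    unfolding plancherel by (rule sum_abs)
  also have "\<dots> \<le> (\<Sum>S\<in>Pow {1..n}. b * \<bar>fourier n g S\<bar>)"
    unfolding abs_mult using fourier_le_Linf assms
    by (intro sum_mono mult_right_mono) (auto intro: order_trans)
  finally show ?thesis unfolding L1_def sum_distrib_left .
qed

section \<open>Projection onto the spectral ball\<close>

lemma norm2_le_iff: "norm2 n f \<le> norm2 n g \<longleftrightarrow> expect n (\<lambda>x. (f x)\<^sup>2) \<le> expect n (\<lambda>x. (g x)\<^sup>2)"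
  unfolding norm2_def by simp

text \<open>Compactness in coefficient space. Attainment matters because \<open>proj_K\<close> is a
  Hilbert choice, which says nothing unless a minimiser exists.\<close>

lemma ex_projection:
  assumes "0 \<le> k"
  shows "\<exists>Q\<in>L1_ball n k. \<forall>Q'\<in>L1_ball n k. norm2 n (\<lambda>x. Q x - P x) \<le> norm2 n (\<lambda>x. Q' x - P x)"
proof -
  define I where "I = Pow {1..n}"
  \<comment> \<open>Coefficient vectors are indexed by the infinite type \<open>nat set\<close>;
    pinning those outside \<open>I\<close> to 0 leaves a product of compact sets, compact by
    Tychonoff.\<close>
  define box :: "(nat set \<Rightarrow> real) set" where "box = PiE UNIV (\<lambda>S. if S \<in> I then {-k..k} else {0})"
  define C where "C = box \<inter> {c. (\<Sum>S\<in>I. \<bar>c S\<bar>) \<le> k}"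
  define \<phi> where "\<phi> c = (\<Sum>S\<in>I. (c S - fourier n P S)\<^sup>2)" for c
  have "compact box"
    unfolding compactin_euclidean_iff[symmetric] euclidean_product_topology[symmetric] box_def
    by (subst compactin_PiE) auto
  moreover have "closed {c :: nat set \<Rightarrow> real. (\<Sum>S\<in>I. \<bar>c S\<bar>) \<le> k}"
    by (intro closed_Collect_le continuous_intros) auto
  ultimately have "compact C" unfolding C_def by (rule compact_Int_closed)
  moreover have "(\<lambda>_. 0) \<in> C" using assms by (auto simp: C_def box_def)
  then have "C \<noteq> {}" by blast
  moreover have "continuous_on C \<phi>"
    unfolding \<phi>_def by (intro continuous_intros continuous_on_subset[OF continuous_on_product_coordinates]) auto
  ultimately obtain c where c: "c \<in> C" and min: "\<And>d. d \<in> C \<Longrightarrow> \<phi> c \<le> \<phi> d"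
    by (metis continuous_attains_inf)
  define Q where "Q x = (\<Sum>T\<in>Pow {1..n}. c T * walsh T x)" for x
  have Q: "fourier n Q S = c S" if "S \<in> I" for S
    using that unfolding Q_def I_def by (intro fourier_synthesis) auto
  have "L1 n Q = (\<Sum>S\<in>I. \<bar>c S\<bar>)" unfolding L1_def using Q by (simp add: I_def)
  then have "Q \<in> L1_ball n k" using c by (simp add: L1_ball_def C_def)
  moreover have "norm2 n (\<lambda>x. Q x - P x) \<le> norm2 n (\<lambda>x. Q' x - P x)" if "Q' \<in> L1_ball n k" for Q'
  proof -
    define d where "d S = (if S \<in> I then fourier n Q' S else 0)" for S
    have L1Q': "(\<Sum>S\<in>I. \<bar>fourier n Q' S\<bar>) \<le> k"
      using that by (simp add: L1_ball_def L1_def I_def)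
    have "\<bar>fourier n Q' S\<bar> \<le> k" if "S \<in> I" for S
      using L1Q' member_le_sum[of S I "\<lambda>S. \<bar>fourier n Q' S\<bar>"] that by (simp add: I_def)
    then have "d \<in> C"
      using L1Q' unfolding C_def box_def d_def
      by (auto simp: abs_le_iff) (smt (verit))+
    from min[OF this] show ?thesis
      unfolding norm2_le_iff parseval \<phi>_def fourier_diff using Q by (simp add: d_def I_def)
  qed
  ultimately show ?thesis by blast
qed

lemma
  assumes "0 \<le> k"
  shows proj_K_in_ball: "L1 n (proj_K n k P) \<le> k"
    and proj_K_minimal: "L1 n Q \<le> k \<Longrightarrow>
      expect n (\<lambda>x. (proj_K n k P x - P x)\<^sup>2) \<le> expect n (\<lambda>x. (Q x - P x)\<^sup>2)"
proof -
  have "is_arg_min (\<lambda>Q. norm2 n (\<lambda>x. Q x - P x)) (\<lambda>Q. Q \<in> L1_ball n k) (proj_K n k P)"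
    unfolding proj_K_def arg_min_on_def arg_min_def
    using ex_projection[OF assms, of n P]
    by (intro someI_ex[where P = "is_arg_min _ _"]) (auto simp: is_arg_min_linorder)
  then show "L1 n (proj_K n k P) \<le> k"
    "L1 n Q \<le> k \<Longrightarrow> expect n (\<lambda>x. (proj_K n k P x - P x)\<^sup>2) \<le> expect n (\<lambda>x. (Q x - P x)\<^sup>2)"
    by (auto simp: is_arg_min_linorder L1_ball_def norm2_le_iff)
qed

text \<open>First-order optimality: the segment from the projection \<open>Q\<close> to
  \<open>P\<close> stays in the ball, and moving a fraction \<open>s\<close> along it changes the
  squared distance to \<open>F\<close> by \<open>s\<^sup>2 * b - 2 * s * a\<close>, which cannot be
  negative.\<close>

lemma proj_K_variational:
  assumes k: "0 \<le> k" and P: "L1 n P \<le> k"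
  shows "expect n (\<lambda>x. (F x - proj_K n k F x) * (P x - proj_K n k F x)) \<le> 0"
proof -
  define Q where "Q = proj_K n k F"
  define a where "a = expect n (\<lambda>x. (F x - Q x) * (P x - Q x))"
  define b where "b = expect n (\<lambda>x. (P x - Q x)\<^sup>2)"
  have bound: "2 * a \<le> s * b" if s: "0 < s" "s \<le> 1" for s
  proof -
    define D where "D x = (1 - s) * Q x + s * P x" for x
    have "L1 n D \<le> (1 - s) * L1 n Q + s * L1 n P"
      unfolding D_def using s by (intro order_trans[OF L1_add]) (simp add: L1_cmult)
    also have "\<dots> \<le> (1 - s) * k + s * k"
      using s P proj_K_in_ball[OF k, of n F] unfolding Q_def
      by (intro add_mono mult_left_mono) auto
    finally have "L1 n D \<le> k" by (simp add: algebra_simps)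
    from proj_K_minimal[OF k this, of F]
    have "expect n (\<lambda>x. (Q x - F x)\<^sup>2) \<le> expect n (\<lambda>x. (D x - F x)\<^sup>2)"
      by (simp add: Q_def)
    also have "(\<lambda>x. (D x - F x)\<^sup>2) =
        (\<lambda>x. ((Q x - F x)\<^sup>2 + s\<^sup>2 * (P x - Q x)\<^sup>2) - 2 * s * ((F x - Q x) * (P x - Q x)))"
      by (simp add: D_def fun_eq_iff power2_eq_square algebra_simps)
    also have "expect n \<dots> = expect n (\<lambda>x. (Q x - F x)\<^sup>2) + s\<^sup>2 * b - 2 * s * a"
      unfolding a_def b_def by (simp only: expect_add expect_diff expect_cmult)
    finally have "s * (2 * a) \<le> s * (s * b)" by (simp add: power2_eq_square)
    then show ?thesis using s by simp
  qed
  \<comment> \<open>Letting \<open>s\<close> tend to 0 from the right removes the quadratic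
    term.\<close>
  have "2 * a \<le> 0"
  proof (rule tendsto_lowerbound)
    show "((\<lambda>s. s * b) \<longlongrightarrow> 0) (at_right 0)" by real_asymp
    have "\<forall>\<^sub>F s in at_right 0. s \<in> {0<..<1::real}"
      by (rule eventually_at_right_real) simp
    then show "\<forall>\<^sub>F s in at_right 0. 2 * a \<le> s * b"
      by (rule eventually_mono) (auto intro: bound)
  qed auto
  then show ?thesis by (simp add: a_def Q_def)
qed

text \<open>Zeroing a coefficient that \<open>F\<close> lacks stays in the ball and comes strictly
  closer to \<open>F\<close>. The resulting sparsity bounds the cost of using the projection as an
  oracle.\<close>

lemma supp_proj_K:
  assumes k: "0 \<le> k"
  shows "supp n (proj_K n k F) \<subseteq> supp n F"
proof (rule ccontr)
  assume "\<not> supp n (proj_K n k F) \<subseteq> supp n F"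
  then obtain S where S: "S \<in> Pow {1..n}" "fourier n F S = 0" "fourier n (proj_K n k F) S \<noteq> 0"
    by (auto simp: supp_def)
  define Q where "Q = proj_K n k F"
  define D where "D x = (\<Sum>T\<in>Pow {1..n}. (if T = S then 0 else fourier n Q T) * walsh T x)" for x
  have D: "fourier n D T = (if T = S then 0 else fourier n Q T)" if "T \<in> Pow {1..n}" for T
    using that unfolding D_def by (intro fourier_synthesis) auto
  have "L1 n D \<le> L1 n Q" unfolding L1_def by (intro sum_mono) (simp add: D)
  then have "L1 n D \<le> k" using proj_K_in_ball[OF k, of n F] by (simp add: Q_def)
  from proj_K_minimal[OF k this, of F]
  have "(\<Sum>T\<in>Pow {1..n}. (fourier n Q T - fourier n F T)\<^sup>2) \<le> (\<Sum>T\<in>Pow {1..n}. (fourier n D T - fourier n F T)\<^sup>2)"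
    unfolding parseval fourier_diff Q_def .
  moreover have "(\<Sum>T\<in>Pow {1..n}. (fourier n D T - fourier n F T)\<^sup>2) < (\<Sum>T\<in>Pow {1..n}. (fourier n Q T - fourier n F T)\<^sup>2)"
  proof (rule sum_strict_mono_ex1)
    show "\<exists>T\<in>Pow {1..n}. (fourier n D T - fourier n F T)\<^sup>2 < (fourier n Q T - fourier n F T)\<^sup>2"
      using S D by (intro bexI[of _ S]) (auto simp: Q_def)
  qed (use D S in auto)
  ultimately show False by simp
qed

section \<open>Programs\<close>

definition result :: "(point \<Rightarrow> real) \<Rightarrow> 'a prog \<Rightarrow> 'a pmf" where
  "result f p = map_pmf fst (run f p)"

text \<open>Time is bounded on every outcome of positive probability. The set \<open>V\<close>
  carries an invariant of the value, on which the cost of the continuation may depend.\<close>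

definition terminates_in :: "(point \<Rightarrow> real) \<Rightarrow> 'a prog \<Rightarrow> nat \<Rightarrow> 'a set \<Rightarrow> bool" where
  "terminates_in f p c V \<longleftrightarrow> (\<forall>(v, t)\<in>set_pmf (run f p). t \<le> c \<and> v \<in> V)"

lemma run_bind_prog:
  fixes p :: "'a prog" and g :: "'a \<Rightarrow> 'b prog"
  shows "run f (bind_prog p g) =
    bind_pmf (run f p) (\<lambda>(a, t). map_pmf (apsnd ((+) t)) (run f (g a)))"
proof (induction p)
  case (Return a)
  have "apsnd ((+) 0) = (id :: 'b \<times> nat \<Rightarrow> _)" by auto
  then show ?case by (simp add: bind_return_pmf pmf.map_id0)
qed (simp_all add: map_bind_pmf bind_map_pmf map_pmf_comp bind_assoc_pmf case_prod_beta o_def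
    apsnd_compose add.assoc apsnd_def map_prod_def)

lemma result_bind_prog: "result f (bind_prog p g) = bind_pmf (result f p) (\<lambda>a. result f (g a))"
  unfolding result_def run_bind_prog
  by (simp add: map_bind_pmf bind_map_pmf map_pmf_comp case_prod_beta)

lemma result_Return [simp]: "result f (Return a) = return_pmf a"
  by (simp add: result_def)

lemma result_Query [simp]: "result f (Query x c) = result f (c (f x))"
  by (simp add: result_def map_pmf_comp)

lemma result_Flip [simp]:
  "result f (Flip c) = bind_pmf (bernoulli_pmf (1/2)) (\<lambda>b. result f (c b))"
  by (simp add: result_def map_bind_pmf map_pmf_comp)

lemma result_Spend [simp]: "result f (Spend m p) = result f p"
  by (simp add: result_def map_pmf_comp)

lemma terminates_in_bind:
  assumes "terminates_in f p c V" "\<And>v. v \<in> V \<Longrightarrow> terminates_in f (g v) c' W"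
  shows "terminates_in f (bind_prog p g) (c + c') W"
  using assms unfolding terminates_in_def run_bind_prog
  by (fastforce intro: add_mono)

lemma terminates_in_mono:
  "terminates_in f p c V \<Longrightarrow> c \<le> c' \<Longrightarrow> V \<subseteq> V' \<Longrightarrow> terminates_in f p c' V'"
  unfolding terminates_in_def by fastforce

lemma terminates_in_Return: "v \<in> V \<Longrightarrow> terminates_in f (Return v) 0 V"
  by (simp add: terminates_in_def)

lemma terminates_in_spend: "terminates_in f (spend m) m UNIV"
  by (simp add: terminates_in_def spend_def)

lemma terminates_in_query: "terminates_in f (query x) 1 UNIV"
  by (simp add: terminates_in_def query_def)

lemma terminates_in_flip: "terminates_in f flip 1 UNIV"
  by (auto simp: terminates_in_def flip_def)

lemma result_simulate:
  assumes "\<And>x. result f (h x) = return_pmf (q x)"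
  shows "result f (simulate h p) = result q p"
  by (induction p) (simp_all add: result_bind_prog assms bind_return_pmf)

text \<open>Every step of the simulated run is charged \<open>c\<close>. A query adds exactly
  \<open>c\<close>; coins and local steps keep their own cost, and \<open>1 \<le> c\<close> makes
  the charge cover them.\<close>

lemma terminates_in_simulate:
  assumes h: "\<And>x. run f (h x) = return_pmf (q x, c)" and c: "1 \<le> c"
    and p: "terminates_in q p N V"
  shows "terminates_in f (simulate h p) (N * c) V"
proof -
  have "\<exists>t'. (v, t') \<in> set_pmf (run q p) \<and> t \<le> t' * c"
    if "(v, t) \<in> set_pmf (run f (simulate h p))" for v t
    using that
  proof (induction p arbitrary: v t)
    case (Query x k)
    from Query.prems obtain t1 where t1: "(v, t1) \<in> set_pmf (run f (simulate h (k (q x))))" "t = c + t1"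
      by (auto simp: run_bind_prog h bind_return_pmf)
    from Query.IH[OF _ t1(1)] obtain t2 where t2: "(v, t2) \<in> set_pmf (run q (k (q x)))" "t1 \<le> t2 * c"
      by auto
    have "(v, Suc t2) \<in> set_pmf (run q (Query x k))"
      using t2(1) by force
    then show ?case using t1 t2 by (intro exI[of _ "Suc t2"]) auto
  next
    case (Flip k)
    from Flip.prems obtain b t1 where t1: "(v, t1) \<in> set_pmf (run f (simulate h (k b)))" "t = Suc t1"
      by auto
    from Flip.IH[OF _ t1(1)] obtain t2 where t2: "(v, t2) \<in> set_pmf (run q (k b))" "t1 \<le> t2 * c"
      by auto
    have "(v, Suc t2) \<in> set_pmf (run q (Flip k))"
      using t2(1) by (cases b) force+
    then show ?case using t1 t2 c by (intro exI[of _ "Suc t2"]) auto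
  next
    case (Spend m k)
    from Spend.prems obtain t1 where t1: "(v, t1) \<in> set_pmf (run f (simulate h k))" "t = m + t1"
      by auto
    from Spend.IH[OF t1(1)] obtain t2 where t2: "(v, t2) \<in> set_pmf (run q k)" "t1 \<le> t2 * c"
      by auto
    have "(v, m + t2) \<in> set_pmf (run q (Spend m k))"
      using t2(1) by force
    moreover have "m + t1 \<le> (m + t2) * c"
      using t2(2) c by (simp add: add_mult_distrib add_mono)
    ultimately show ?case using t1 by blast
  qed auto
  then show ?thesis
    using p unfolding terminates_in_def
    by (fastforce elim: order_trans intro: mult_le_mono1)
qed

text \<open>Union bound for two dependent stages: the failure probability of the second is at most
  \<open>1\<close> outside \<open>A\<close> and \<open>\<beta>\<close> inside, and the integral of
  that bound is \<open>\<alpha> + \<beta>\<close> at most.\<close>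

lemma prob_bind_pmf_le:
  assumes "measure_pmf.prob M (- A) \<le> \<alpha>" "0 \<le> \<beta>"
    and "\<And>x. x \<in> set_pmf M \<Longrightarrow> x \<in> A \<Longrightarrow> measure_pmf.prob (N x) B \<le> \<beta>"
  shows "measure_pmf.prob (bind_pmf M N) B \<le> \<alpha> + \<beta>"
proof -
  have \<alpha>: "0 \<le> \<alpha>" using assms(1) measure_nonneg order_trans by blast
  have "emeasure (bind_pmf M N) B = (\<integral>\<^sup>+x. emeasure (N x) B \<partial>M)" by simp
  also have "\<dots> \<le> (\<integral>\<^sup>+x. indicator (- A) x + ennreal \<beta> \<partial>M)"
  proof (intro nn_integral_mono_AE AE_pmfI)
    fix x assume "x \<in> set_pmf M"
    then show "emeasure (N x) B \<le> indicator (- A) x + ennreal \<beta>"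
      using assms(3)[of x] measure_pmf.emeasure_le_1[of "N x" B]
      by (cases "x \<in> A")
         (auto simp: measure_pmf.emeasure_eq_measure ennreal_leI intro: add_increasing2)
  qed
  also have "\<dots> = ennreal (measure_pmf.prob M (- A)) + ennreal \<beta>"
    by (subst nn_integral_add) (auto simp: measure_pmf.emeasure_eq_measure measure_pmf.emeasure_space_1)
  also have "\<dots> \<le> ennreal (\<alpha> + \<beta>)"
    using assms(1,2) \<alpha> by (subst ennreal_plus) (auto intro!: add_mono ennreal_leI)
  finally show ?thesis
    using \<alpha> assms(2) by (simp add: measure_pmf.emeasure_eq_measure del: ennreal_plus)
qed

section \<open>Random examples\<close>

lemma result_random_point: "result f (random_point n) = pmf_of_set (cube n)"
proof (induction n)
  case 0
  have "cube 0 = {\<lambda>_. undefined}" by (simp add: cube_def)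
  then show ?case by (simp add: pmf_of_set_singleton)
next
  case (Suc n)
  let ?g = "\<lambda>(b, x). x(Suc n := if b then 1 else -1 :: real)"
  have cube: "cube (Suc n) = ?g ` (UNIV \<times> cube n)"
  proof -
    have "{1..Suc n} = insert (Suc n) {1..n}" by auto
    then have "cube (Suc n) = (\<lambda>(y, g). g(Suc n := y)) ` ({-1, 1} \<times> cube n)"
      unfolding cube_def by (simp add: PiE_insert_eq)
    also have "{-1, 1 :: real} = (\<lambda>b. if b then 1 else -1) ` UNIV"
      by (simp add: UNIV_bool insert_commute)
    also have "\<dots> \<times> cube n = (\<lambda>(b, x). (if b then 1 else -1, x)) ` (UNIV \<times> cube n)"
      by (simp add: image_paired_Times)
    finally show ?thesis by (simp only: image_image case_prod_unfold fst_conv snd_conv)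
  qed
  \<comment> \<open>Injectivity by counting: the image is \<open>cube (Suc n)\<close>, which has as
    many elements as the domain.\<close>
  have inj: "inj_on ?g (UNIV \<times> cube n)"
  proof (rule eq_card_imp_inj_on)
    show "card (?g ` (UNIV \<times> cube n)) = card ((UNIV :: bool set) \<times> cube n)"
      by (simp flip: cube add: card_cartesian_product)
  qed auto
  have coin: "bernoulli_pmf (1/2) = pmf_of_set (UNIV :: bool set)"
    by (rule pmf_eqI) (auto simp: pmf_bernoulli_half)
  have "result f (random_point (Suc n)) =
      map_pmf ?g (pair_pmf (pmf_of_set UNIV) (pmf_of_set (cube n)))"
    by (simp add: result_bind_prog flip_def Suc coin pair_pmf_def map_bind_pmf bind_assoc_pmf
        bind_return_pmf map_return_pmf)
  also have "pair_pmf (pmf_of_set (UNIV :: bool set)) (pmf_of_set (cube n)) = pmf_of_set (UNIV \<times> cube n)"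
    by (rule pmf_eqI) (auto simp: pmf_pair indicator_def card_cartesian_product split: if_splits)
  also have "map_pmf ?g \<dots> = pmf_of_set (cube (Suc n))"
    unfolding cube by (rule map_pmf_of_set_inj[OF inj]) auto
  finally show ?case .
qed

lemma terminates_in_random_point: "terminates_in f (random_point n) n UNIV"
proof (induction n)
  case (Suc n)
  show ?case unfolding random_point.simps
    by (rule terminates_in_mono[where V = UNIV])
       (rule terminates_in_bind[OF terminates_in_flip] terminates_in_bind[OF Suc] terminates_in_Return UNIV_I | simp)+
qed (simp add: terminates_in_Return)

lemma terminates_in_labelled_sample: "terminates_in f (labelled_sample n m) (m * (n + 1)) UNIV"
proof (induction m)
  case (Suc m)
  show ?case unfolding labelled_sample.simps
    by (rule terminates_in_mono[where V = UNIV])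
       (rule terminates_in_bind[OF terminates_in_random_point] terminates_in_bind[OF terminates_in_query]
         terminates_in_bind[OF Suc] terminates_in_Return UNIV_I | simp)+
qed (simp add: terminates_in_Return)

lemma result_labelled_sample_Suc:
  "result f (labelled_sample n (Suc m)) =
    bind_pmf (pmf_of_set (cube n)) (\<lambda>x. map_pmf ((#) (x, f x)) (result f (labelled_sample n m)))"
  by (simp add: result_bind_prog result_random_point query_def bind_return_pmf map_pmf_def)

lemma length_labelled_sample: "zs \<in> set_pmf (result f (labelled_sample n m)) \<Longrightarrow> length zs = m"
proof (induction m arbitrary: zs)
  case (Suc m)
  then show ?case by (auto simp: result_labelled_sample_Suc simp del: labelled_sample.simps)
qed simp

text \<open>Each recursive call draws a fresh point, so the moment generating function factorises;
  Hoeffding's lemma bounds a factor for a range of length 1. The offset \<open>a\<close> stays free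
  so that \<open>g\<close> and \<open>- g\<close> are both covered.\<close>

lemma labelled_sample_mgf:
  assumes g: "\<And>x. x \<in> cube n \<Longrightarrow> g (x, f x) \<in> {a..a + 1}" and l: "0 < l"
  defines "\<mu> \<equiv> expect n (\<lambda>x. g (x, f x))"
  shows "(\<integral>\<^sup>+zs. ennreal (exp (l * (\<Sum>z\<leftarrow>zs. g z - \<mu>))) \<partial>result f (labelled_sample n m))
    \<le> ennreal (exp (real m * l\<^sup>2 / 8))"
proof (induction m)
  case (Suc m)
  let ?M = "pmf_of_set (cube n)" and ?S = "\<lambda>zs. \<Sum>z\<leftarrow>zs. g z - \<mu>"
  have set: "set_pmf ?M = cube n" by simp
  interpret interval_bounded_random_variable ?M "\<lambda>x. g (x, f x)" a "a + 1"
    by unfold_locales (use g in \<open>auto simp: AE_measure_pmf_iff set\<close>)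
  have one: "(\<integral>\<^sup>+x. ennreal (exp (l * (g (x, f x) - \<mu>))) \<partial>?M) \<le> ennreal (exp (l\<^sup>2 / 8))"
    using Hoeffdings_lemma_nn_integral[OF l] unfolding \<mu>_def expect_def by simp
  have "(\<integral>\<^sup>+zs. ennreal (exp (l * ?S zs)) \<partial>result f (labelled_sample n (Suc m))) =
      (\<integral>\<^sup>+x. \<integral>\<^sup>+zs. ennreal (exp (l * (g (x, f x) - \<mu>))) * ennreal (exp (l * ?S zs))
        \<partial>result f (labelled_sample n m) \<partial>?M)"
    unfolding result_labelled_sample_Suc
    by (simp add: distrib_left exp_add ennreal_mult)
  also have "\<dots> = (\<integral>\<^sup>+x. ennreal (exp (l * (g (x, f x) - \<mu>))) \<partial>?M) *
      (\<integral>\<^sup>+zs. ennreal (exp (l * ?S zs)) \<partial>result f (labelled_sample n m))"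
    by (simp add: nn_integral_cmult nn_integral_multc)
  also have "\<dots> \<le> ennreal (exp (l\<^sup>2 / 8)) * ennreal (exp (real m * l\<^sup>2 / 8))"
    by (intro mult_mono one Suc) auto
  also have "\<dots> = ennreal (exp (real (Suc m) * l\<^sup>2 / 8))"
    by (simp add: exp_add[symmetric] field_simps flip: ennreal_mult)
  finally show ?case .
qed simp

lemma labelled_sample_tail:
  assumes g: "\<And>x. x \<in> cube n \<Longrightarrow> g (x, f x) \<in> {a..a + 1}" and s: "0 < s" and m: "0 < m"
  shows "measure_pmf.prob (result f (labelled_sample n m))
      {zs. expect n (\<lambda>x. g (x, f x)) + s \<le> (\<Sum>z\<leftarrow>zs. g z) / real (length zs)}
    \<le> exp (- 2 * real m * s\<^sup>2)"
proof -
  define \<mu> where "\<mu> = expect n (\<lambda>x. g (x, f x))"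
  \<comment> \<open>Minimises the Chernoff exponent \<open>- l * m * s + m * l\<^sup>2 / 8\<close>,
    with value \<open>- 2 * m * s\<^sup>2\<close>.\<close>
  define l where "l = 4 * s"
  let ?M = "result f (labelled_sample n m)" and ?S = "\<lambda>zs. \<Sum>z\<leftarrow>zs. g z - \<mu>"
  let ?A = "{zs. \<mu> + s \<le> (\<Sum>z\<leftarrow>zs. g z) / real (length zs)}"
  have "emeasure ?M ?A = (\<integral>\<^sup>+zs. indicator ?A zs \<partial>?M)" by simp
  also have "\<dots> \<le> (\<integral>\<^sup>+zs. ennreal (exp (- l * m * s)) * ennreal (exp (l * ?S zs)) \<partial>?M)"
  proof (intro nn_integral_mono_AE AE_pmfI)
    fix zs assume "zs \<in> set_pmf ?M"
    then have len: "length zs = m" by (rule length_labelled_sample)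
    show "indicator ?A zs \<le> ennreal (exp (- l * m * s)) * ennreal (exp (l * ?S zs))"
    proof (cases "zs \<in> ?A")
      case True
      then have "m * s \<le> ?S zs"
        using len m by (simp add: sum_list_subtractf sum_list_triv field_simps)
      then have "0 \<le> - l * m * s + l * ?S zs"
        using s by (simp add: l_def)
      then have "1 \<le> exp (- l * m * s) * exp (l * ?S zs)"
        by (simp flip: exp_add)
      then show ?thesis using True by (simp flip: ennreal_mult)
    qed simp
  qed
  also have "\<dots> = ennreal (exp (- l * m * s)) * (\<integral>\<^sup>+zs. ennreal (exp (l * ?S zs)) \<partial>?M)"
    by (simp add: nn_integral_cmult)
  also have "\<dots> \<le> ennreal (exp (- l * m * s)) * ennreal (exp (real m * l\<^sup>2 / 8))"
    unfolding \<mu>_def using g s by (intro mult_left_mono labelled_sample_mgf) (auto simp: l_def)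
  also have "\<dots> = ennreal (exp (- 2 * real m * s\<^sup>2))"
    by (simp add: exp_add[symmetric] l_def power2_eq_square algebra_simps flip: ennreal_mult)
  finally show ?thesis by (simp add: measure_pmf.emeasure_eq_measure \<mu>_def)
qed

section \<open>Analysis of KMtron\<close>

definition recovers :: "nat \<Rightarrow> real \<Rightarrow> real \<Rightarrow> (point \<Rightarrow> real) \<Rightarrow> (point \<Rightarrow> real) \<Rightarrow> bool" where
  "recovers n \<gamma> \<theta> Q Q' \<longleftrightarrow>
    Linf n (\<lambda>x. Q x - Q' x) \<le> \<theta> \<and> (\<forall>S\<in>supp n Q'. \<gamma> * \<theta> \<le> \<bar>fourier n Q S\<bar>)"

text \<open>On the support of \<open>Q'\<close> the error is at most \<open>\<theta>\<close>, hence
  at most \<open>1 / \<gamma>\<close> times the coefficient of \<open>Q\<close>; off the support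
  \<open>Q'\<close> contributes nothing.\<close>

lemma recovers_L1:
  assumes "recovers n \<gamma> \<theta> Q Q'" "0 < \<gamma>"
  shows "L1 n Q' \<le> (1 + 1 / \<gamma>) * L1 n Q"
proof -
  have "\<bar>fourier n Q' S\<bar> \<le> (1 + 1 / \<gamma>) * \<bar>fourier n Q S\<bar>" if S: "S \<in> Pow {1..n}" for S
  proof (cases "S \<in> supp n Q'")
    case True
    have "\<bar>fourier n Q S - fourier n Q' S\<bar> \<le> \<theta>"
      using assms(1) fourier_le_Linf[of S n "\<lambda>x. Q x - Q' x"] S
      by (auto simp: recovers_def fourier_diff)
    moreover have "\<theta> \<le> \<bar>fourier n Q S\<bar> / \<gamma>"
      using assms True by (auto simp: recovers_def field_simps)
    ultimately show ?thesis by (simp add: distrib_right)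
  next
    case False
    then show ?thesis using S assms(2) by (simp add: supp_def)
  qed
  then show ?thesis unfolding L1_def sum_distrib_left by (intro sum_mono)
qed

locale glm =
  fixes n :: nat and u :: "real \<Rightarrow> real" and P :: "point \<Rightarrow> real" and k L :: real
  assumes mono_u: "mono u" and lipschitz_u: "L-lipschitz_on UNIV u"
    and range_u: "range u \<subseteq> {0..1}" and L1_P: "L1 n P \<le> k"
    and k_pos: "0 < k" and L_pos: "0 < L"
begin

definition dist2 :: "(point \<Rightarrow> real) \<Rightarrow> real" where
  "dist2 F = expect n (\<lambda>x. (P x - F x)\<^sup>2)"

lemma u_bounds: "0 \<le> u x" "u x \<le> 1"
  using subsetD[OF range_u rangeI[of u x]] by simp_all

lemma u_lipschitz: "\<bar>u x - u y\<bar> \<le> L * \<bar>x - y\<bar>"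
  using lipschitz_onD[OF lipschitz_u, of x y] by (simp add: dist_real_def)

text \<open>Apply the Lipschitz bound to one factor of the square; by monotonicity both differences
  have the same sign, so the absolute values can be removed.\<close>

lemma u_correlation: "(u x - u y)\<^sup>2 \<le> L * ((u x - u y) * (x - y))"
proof -
  have "(u x - u y)\<^sup>2 = \<bar>u x - u y\<bar> * \<bar>u x - u y\<bar>" by (simp add: power2_eq_square)
  also have "\<dots> \<le> \<bar>u x - u y\<bar> * (L * \<bar>x - y\<bar>)"
    using u_lipschitz by (intro mult_left_mono) auto
  also have "\<bar>u x - u y\<bar> * \<bar>x - y\<bar> = (u x - u y) * (x - y)"
    using monoD[OF mono_u, of x y] monoD[OF mono_u, of y x]
    by (cases "x \<le> y") (auto simp: abs_if algebra_simps)
  then have "\<bar>u x - u y\<bar> * (L * \<bar>x - y\<bar>) = L * ((u x - u y) * (x - y))"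
    by (simp add: mult.left_commute)
  finally show ?thesis .
qed

lemma residual_sq_bounds: "(u x - u y)\<^sup>2 \<in> {0..1}"
  using u_bounds[of x] u_bounds[of y] by (simp add: abs_square_le_1)

lemma err_nonneg: "0 \<le> err n u P F"
  unfolding err_def by (rule expect_nonneg) simp

lemma err_le_1: "err n u P F \<le> 1"
  unfolding err_def using expect_mono[of n _ "\<lambda>_. 1"] residual_sq_bounds by simp

lemma err_le_dist2: "err n u P F \<le> L\<^sup>2 * dist2 F"
  unfolding err_def dist2_def expect_cmult[symmetric]
proof (rule expect_mono)
  fix x
  have "\<bar>u (P x) - u (F x)\<bar>\<^sup>2 \<le> (L * \<bar>P x - F x\<bar>)\<^sup>2"
    by (intro power_mono u_lipschitz) auto
  then show "(u (P x) - u (F x))\<^sup>2 \<le> L\<^sup>2 * (P x - F x)\<^sup>2"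
    by (simp add: power_mult_distrib)
qed

lemma dist2_le: "L1 n F \<le> b \<Longrightarrow> dist2 F \<le> (k + b)\<^sup>2"
proof -
  assume "L1 n F \<le> b"
  then have "L2 n (\<lambda>x. P x - F x) \<le> k + b"
    using L2_le_L1[of n "\<lambda>x. P x - F x"] L1_diff[of n P F] L1_P by linarith
  then show ?thesis
    unfolding dist2_def L2_squared[symmetric] by (intro power_mono L2_nonneg)
qed

text \<open>The event that both calls of \<open>KM\<close> succeed. \<open>R\<close> is quantified
  away because a run records only the iterates.\<close>

definition good_step :: "real \<Rightarrow> real \<Rightarrow> real \<Rightarrow> (point \<Rightarrow> real) \<Rightarrow> (point \<Rightarrow> real) \<Rightarrow> bool" where
  "good_step \<gamma> \<theta> lr F F' \<longleftrightarrow> (\<exists>R. recovers n \<gamma> \<theta> (\<lambda>x. u (P x) - u (F x)) R \<and>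
    recovers n \<gamma> \<theta> (proj_K n k (\<lambda>x. F x + lr * R x)) F')"

lemma good_step_L1:
  assumes "good_step \<gamma> \<theta> lr F F'" "0 < \<gamma>"
  shows "L1 n F' \<le> (1 + 1 / \<gamma>) * k"
proof -
  obtain R where R: "recovers n \<gamma> \<theta> (proj_K n k (\<lambda>x. F x + lr * R x)) F'"
    using assms(1) by (auto simp: good_step_def)
  define Q where "Q = proj_K n k (\<lambda>x. F x + lr * R x)"
  have Q: "recovers n \<gamma> \<theta> Q F'" "L1 n Q \<le> k"
    using R k_pos by (simp_all add: Q_def proj_K_in_ball)
  have "L1 n F' \<le> (1 + 1 / \<gamma>) * L1 n Q" by (rule recovers_L1[OF Q(1) assms(2)])
  also have "\<dots> \<le> (1 + 1 / \<gamma>) * k" using Q(2) assms(2) by (intro mult_left_mono) auto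
  finally show ?thesis .
qed

text \<open>
  Replacing the residual \<open>g\<close> by its sparse approximation \<open>R\<close> may change the 2-norm a lot. The
  error is only ever paired with \<open>P - Q\<close>, whose \<open>L1\<close> norm is at most \<open>2 * k\<close>, because the
  projection \<open>Q\<close> enters through its variational inequality.
\<close>

lemma good_step_dist2:
  assumes step: "good_step \<gamma> \<theta> lr F F'" and \<gamma>: "0 < \<gamma>" and lr: "0 < lr" "lr \<le> 1" and \<theta>: "0 < \<theta>"
  shows "dist2 F' \<le> dist2 F - (2 * lr / L - lr\<^sup>2) * err n u P F + (8 + 1 / \<gamma>) * k * \<theta>"
proof -
  obtain R where R: "recovers n \<gamma> \<theta> (\<lambda>x. u (P x) - u (F x)) R"
    and F': "recovers n \<gamma> \<theta> (proj_K n k (\<lambda>x. F x + lr * R x)) F'"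
    using step by (auto simp: good_step_def)
  define Q where "Q = proj_K n k (\<lambda>x. F x + lr * R x)"
  define g where "g x = u (P x) - u (F x)" for x
  \<comment> \<open>The step along the exact residual; it occurs only in the analysis.\<close>
  define V where "V x = F x + lr * g x" for x
  have Q_ball: "L1 n Q \<le> k" unfolding Q_def using k_pos by (intro proj_K_in_ball) auto
  have F'_L1: "L1 n F' \<le> (1 + 1 / \<gamma>) * k" by (rule good_step_L1[OF step \<gamma>])

  have "\<bar>expect n (\<lambda>x. (g x - R x) * (P x - Q x))\<bar> \<le> \<theta> * L1 n (\<lambda>x. P x - Q x)"
    using R by (intro expect_mult_le) (simp add: recovers_def g_def)
  also have "\<dots> \<le> \<theta> * (2 * k)"
    using L1_diff[of n P Q] L1_P Q_ball \<theta> by (intro mult_left_mono) auto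
  finally have gR: "expect n (\<lambda>x. (g x - R x) * (P x - Q x)) \<le> \<theta> * (2 * k)" by simp
  have var: "expect n (\<lambda>x. (F x + lr * R x - Q x) * (P x - Q x)) \<le> 0"
    unfolding Q_def using k_pos L1_P by (intro proj_K_variational) auto
  \<comment> \<open>\<open>V\<close> differs from the function that was projected by
    \<open>lr * (g - R)\<close>.\<close>
  have "expect n (\<lambda>x. (V x - Q x) * (P x - Q x)) =
      expect n (\<lambda>x. (F x + lr * R x - Q x) * (P x - Q x)) + lr * expect n (\<lambda>x. (g x - R x) * (P x - Q x))"
    unfolding expect_cmult[symmetric] expect_add[symmetric]
    by (intro expect_cong) (simp add: V_def algebra_simps)
  also have "\<dots> \<le> lr * (\<theta> * (2 * k))"
    using var gR lr by (smt (verit) mult_left_mono)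
  also have "\<dots> \<le> 1 * (\<theta> * (2 * k))"
    using lr \<theta> k_pos by (intro mult_right_mono) auto
  finally have VQ: "expect n (\<lambda>x. (V x - Q x) * (P x - Q x)) \<le> 2 * (\<theta> * k)"
    by (simp add: mult_ac)

  \<comment> \<open>Law of cosines for \<open>V - P = (V - Q) - (P - Q)\<close>, dropping the square
    of \<open>V - Q\<close>.\<close>
  have "dist2 Q \<le> expect n (\<lambda>x. (V x - P x)\<^sup>2 + 2 * ((V x - Q x) * (P x - Q x)))"
    unfolding dist2_def
  proof (rule expect_mono)
    fix x
    have "(V x - P x)\<^sup>2 + 2 * ((V x - Q x) * (P x - Q x)) = (P x - Q x)\<^sup>2 + (V x - Q x)\<^sup>2"
      by (simp add: power2_eq_square algebra_simps)
    then show "(P x - Q x)\<^sup>2 \<le> (V x - P x)\<^sup>2 + 2 * ((V x - Q x) * (P x - Q x))" by simp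
  qed
  also have "\<dots> \<le> expect n (\<lambda>x. (V x - P x)\<^sup>2) + 4 * k * \<theta>"
    using VQ by (simp add: expect_add expect_cmult mult.assoc)
  \<comment> \<open>Pointwise, the cross term gains \<open>2 * lr / L\<close> times the squared
    residual by \<open>u_correlation\<close>, and the quadratic term costs \<open>lr\<^sup>2\<close>
    times it.\<close>
  also have "expect n (\<lambda>x. (V x - P x)\<^sup>2) \<le>
      expect n (\<lambda>x. (P x - F x)\<^sup>2 - (2 * lr / L - lr\<^sup>2) * (u (P x) - u (F x))\<^sup>2)"
  proof (rule expect_mono)
    fix x
    have "(V x - P x)\<^sup>2 = (P x - F x)\<^sup>2 - 2 * lr * (g x * (P x - F x)) + lr\<^sup>2 * (g x)\<^sup>2"
      by (simp add: V_def power2_eq_square algebra_simps)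
    moreover have "lr * ((g x)\<^sup>2 / L) \<le> lr * (g x * (P x - F x))"
      using u_correlation[of "P x" "F x"] lr L_pos unfolding g_def
      by (intro mult_left_mono) (auto simp: field_simps)
    moreover have "(2 * lr / L - lr\<^sup>2) * (g x)\<^sup>2 = 2 * (lr * ((g x)\<^sup>2 / L)) - lr\<^sup>2 * (g x)\<^sup>2"
      by (simp add: left_diff_distrib)
    ultimately have "(V x - P x)\<^sup>2 \<le> (P x - F x)\<^sup>2 - (2 * lr / L - lr\<^sup>2) * (g x)\<^sup>2"
      by linarith
    then show "(V x - P x)\<^sup>2 \<le> (P x - F x)\<^sup>2 - (2 * lr / L - lr\<^sup>2) * (u (P x) - u (F x))\<^sup>2"
      by (simp only: g_def)
  qed
  also have "\<dots> = dist2 F - (2 * lr / L - lr\<^sup>2) * err n u P F"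
    by (simp add: dist2_def err_def expect_diff expect_cmult)
  finally have Q_dist: "dist2 Q \<le> dist2 F - (2 * lr / L - lr\<^sup>2) * err n u P F + 4 * k * \<theta>" by simp

  have "L1 n (\<lambda>x. (P x - F' x) + (P x - Q x)) \<le> (L1 n P + L1 n F') + (L1 n P + L1 n Q)"
    by (rule order_trans[OF L1_add add_mono[OF L1_diff L1_diff]])
  also have "\<dots> \<le> (k + (1 + 1 / \<gamma>) * k) + (k + k)"
    by (intro add_mono L1_P Q_ball F'_L1)
  also have "\<dots> = (4 + 1 / \<gamma>) * k" by (simp add: distrib_right)
  finally have L1_sum: "L1 n (\<lambda>x. (P x - F' x) + (P x - Q x)) \<le> (4 + 1 / \<gamma>) * k" .
  \<comment> \<open>Factoring the difference of squares keeps the \<open>KM\<close> error linear, so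
    \<open>expect_mult_le\<close> applies.\<close>
  have "dist2 F' - dist2 Q = expect n (\<lambda>x. (Q x - F' x) * ((P x - F' x) + (P x - Q x)))"
    unfolding dist2_def expect_diff[symmetric]
    by (intro expect_cong) (simp add: power2_eq_square algebra_simps)
  also have "\<dots> \<le> \<theta> * L1 n (\<lambda>x. (P x - F' x) + (P x - Q x))"
    using F' by (intro abs_le_D1[OF expect_mult_le]) (simp add: recovers_def Q_def)
  also have "\<dots> \<le> \<theta> * ((4 + 1 / \<gamma>) * k)"
    using L1_sum \<theta> by (intro mult_left_mono) auto
  finally have "dist2 F' - dist2 Q \<le> (4 + 1 / \<gamma>) * k * \<theta>" by (simp only: mult_ac)
  moreover have "4 * k * \<theta> + (4 + 1 / \<gamma>) * k * \<theta> = (8 + 1 / \<gamma>) * k * \<theta>"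
    by (simp add: distrib_right)
  ultimately show ?thesis using Q_dist by linarith
qed

text \<open>Telescopes \<open>good_step_dist2\<close>. The gain of a step is governed by the error
  at its start, which \<open>\<tau>\<close> may replace because its factor is nonnegative.\<close>

lemma good_chain_dist2:
  assumes "successively (good_step \<gamma> \<theta> lr) (F # Fs)" "0 < \<gamma>" "0 < lr" "lr \<le> 1" "0 < \<theta>"
    and c: "0 \<le> 2 * lr / L - lr\<^sup>2" and bad: "\<And>G. G \<in> set (F # Fs) \<Longrightarrow> \<tau> \<le> err n u P G"
  shows "dist2 (last (F # Fs)) \<le>
    dist2 F - real (length Fs) * ((2 * lr / L - lr\<^sup>2) * \<tau> - (8 + 1 / \<gamma>) * k * \<theta>)"
  using assms(1) bad
proof (induction Fs arbitrary: F)
  case (Cons G Fs)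
  have "(2 * lr / L - lr\<^sup>2) * \<tau> \<le> (2 * lr / L - lr\<^sup>2) * err n u P F"
    using Cons.prems(2) c by (intro mult_left_mono) auto
  moreover have "dist2 G \<le> dist2 F - (2 * lr / L - lr\<^sup>2) * err n u P F + (8 + 1 / \<gamma>) * k * \<theta>"
    using Cons.prems(1) assms(2-5) by (intro good_step_dist2) auto
  moreover have "dist2 (last (G # Fs)) \<le>
      dist2 G - real (length Fs) * ((2 * lr / L - lr\<^sup>2) * \<tau> - (8 + 1 / \<gamma>) * k * \<theta>)"
    using Cons.prems by (intro Cons.IH) auto
  ultimately show ?case by (simp add: distrib_right)
qed simp

text \<open>
  The starting point \<open>0\<close> is not a candidate, so only \<open>T - 1\<close> of the \<open>T\<close> steps are known to make
  progress; the slack in \<open>T\<close> covers the missing one. If \<open>k * L\<close> is small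
  compared to \<open>sqrt \<epsilon>\<close>, then \<open>\<theta>\<close> need not be small, but every function of spectral norm \<open>O(k)\<close> is
  good enough.
\<close>

lemma ex_good_iterate:
  assumes chain: "successively (good_step \<gamma> \<theta> lr) ((\<lambda>_. 0) # Fs)" and \<gamma>: "0 < \<gamma>" and \<theta>: "0 < \<theta>"
    and \<epsilon>: "0 < \<epsilon>" "\<epsilon> < 1" and lr: "lr = \<epsilon> / (2 * L)" "lr \<le> 1"
    and ne: "Fs \<noteq> []" and T: "2 * k\<^sup>2 * L\<^sup>2 / \<epsilon>\<^sup>2 \<le> real (length Fs)"
    and \<theta>_le: "\<theta> \<le> 9 / (100 * (8 + 1 / \<gamma>) * (2 + 1 / \<gamma>)\<^sup>2) * \<epsilon> ^ 4 / (L ^ 4 * k ^ 3)"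
  shows "\<exists>F\<in>set Fs. err n u P F \<le> 9 / 10 * \<epsilon>"
proof (rule ccontr)
  assume "\<not> ?thesis"
  then have bad: "\<And>F. F \<in> set Fs \<Longrightarrow> 9 / 10 * \<epsilon> < err n u P F" by force
  obtain F1 Fs' where Fs: "Fs = F1 # Fs'" using ne by (cases Fs) auto
  have step1: "good_step \<gamma> \<theta> lr (\<lambda>_. 0) F1" and chain': "successively (good_step \<gamma> \<theta> lr) (F1 # Fs')"
    using chain Fs by auto
  define a where "a = 2 + 1 / \<gamma>"
  define \<eta> where "\<eta> = (8 + 1 / \<gamma>) * k * \<theta>"
  define c where "c = 2 * lr / L - lr\<^sup>2"
  define q where "q = \<epsilon>\<^sup>2 / L\<^sup>2"
  have a: "0 < a" and b: "0 < 8 + 1 / \<gamma>" using \<gamma> by (auto simp: a_def intro: add_pos_pos)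
  have q: "0 < q" using \<epsilon> L_pos by (simp add: q_def)

  \<comment> \<open>Already the badness of \<open>F1\<close> forces \<open>(L * k)\<^sup>2\<close>
    to be at least of order \<open>\<epsilon>\<close>.\<close>
  have "dist2 F1 \<le> (k + (1 + 1 / \<gamma>) * k)\<^sup>2"
    using good_step_L1[OF step1 \<gamma>] by (rule dist2_le)
  then have "L\<^sup>2 * dist2 F1 \<le> L\<^sup>2 * (a * k)\<^sup>2"
    by (intro mult_left_mono) (auto simp: a_def algebra_simps)
  then have large: "9 / 10 * \<epsilon> < a\<^sup>2 * (L\<^sup>2 * k\<^sup>2)"
    using bad[of F1] err_le_dist2[of F1] Fs by (simp add: power_mult_distrib mult_ac)

  \<comment> \<open>This fixes the exponents and the constant in the bound on
    \<open>\<theta>\<close>: beyond \<open>q\<close> there remains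
    \<open>\<epsilon>\<^sup>2 / (L\<^sup>2 * k\<^sup>2)\<close>, which \<open>large\<close> reduces
    to order \<open>\<epsilon>\<close>, and \<open>9/100\<close> is
    \<open>1/10 * 9/10\<close>.\<close>
  have "\<eta> \<le> (8 + 1 / \<gamma>) * k * (9 / (100 * (8 + 1 / \<gamma>) * a\<^sup>2) * \<epsilon> ^ 4 / (L ^ 4 * k ^ 3))"
    unfolding \<eta>_def using \<theta>_le b k_pos by (intro mult_left_mono) (auto simp: a_def)
  also have "\<dots> = 9 / 100 * \<epsilon>\<^sup>2 * q / (a\<^sup>2 * (L\<^sup>2 * k\<^sup>2))"
  proof -
    have "b * k * (9 / (100 * b * a\<^sup>2) * \<epsilon> ^ 4 / (L ^ 4 * k ^ 3)) = 9 / 100 * \<epsilon>\<^sup>2 * q / (a\<^sup>2 * (L\<^sup>2 * k\<^sup>2))"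
      if "0 < b" for b
      using that k_pos L_pos a unfolding q_def by (simp add: field_simps eval_nat_numeral)
    then show ?thesis using b by blast
  qed
  also have "\<dots> \<le> 9 / 100 * \<epsilon>\<^sup>2 * q / (9 / 10 * \<epsilon>)"
    using large \<epsilon> q by (intro divide_left_mono) auto
  also have "\<dots> = q / 10 * \<epsilon>" using \<epsilon> by (simp add: field_simps power2_eq_square)
  also have "\<dots> \<le> q / 10 * 1" using \<epsilon> q by (intro mult_left_mono) auto
  finally have \<eta>: "\<eta> \<le> q / 10" by simp

  have c_eq: "c * \<epsilon> = q * (1 - \<epsilon> / 4)"
    using L_pos by (simp add: c_def lr(1) q_def field_simps power2_eq_square)
  then have "c * \<epsilon> \<ge> q * (3 / 4)" using q \<epsilon> by simp
  then have gain: "c * (9 / 10 * \<epsilon>) - \<eta> \<ge> q * (23 / 40)"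
    using \<eta> mult.left_commute[of c "9 / 10" \<epsilon>] by linarith
  have "0 < c * \<epsilon>" unfolding c_eq using q \<epsilon> by (intro mult_pos_pos) auto
  then have c: "0 \<le> c" using \<epsilon> by (simp add: zero_less_mult_iff)
  have lr0: "0 < lr" using \<epsilon> L_pos lr by simp

  \<comment> \<open>The error of the starting point has no lower bound but 0, so the first step is
    only known to lose at most \<open>\<eta>\<close>.\<close>
  have "dist2 F1 \<le> dist2 (\<lambda>_. 0) - c * err n u P (\<lambda>_. 0) + \<eta>"
    unfolding c_def \<eta>_def by (rule good_step_dist2[OF step1 \<gamma> lr0 lr(2) \<theta>])
  moreover have "dist2 (\<lambda>_. 0) \<le> k\<^sup>2"
    using dist2_le[of "\<lambda>_. 0" 0] by (simp add: L1_def)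
  moreover have "0 \<le> c * err n u P (\<lambda>_. 0)"
    using c err_nonneg by simp
  ultimately have F1: "dist2 F1 \<le> k\<^sup>2 + \<eta>" by linarith

  have "k\<^sup>2 * (23 / 20) = 2 * k\<^sup>2 * L\<^sup>2 / \<epsilon>\<^sup>2 * (q * (23 / 40))"
    using \<epsilon> L_pos by (simp add: q_def field_simps)
  also have "\<dots> \<le> real (length Fs) * (q * (23 / 40))"
    using T q by (intro mult_right_mono) auto
  also have "\<dots> = real (length Fs') * (q * (23 / 40)) + q * (23 / 40)"
    by (simp add: Fs algebra_simps)
  also have "real (length Fs') * (q * (23 / 40)) \<le> real (length Fs') * (c * (9 / 10 * \<epsilon>) - \<eta>)"
    using gain by (intro mult_left_mono) auto
  finally have gain_total:
    "k\<^sup>2 * (23 / 20) \<le> real (length Fs') * (c * (9 / 10 * \<epsilon>) - \<eta>) + q * (23 / 40)" by simp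

  have "dist2 (last Fs) \<le> dist2 F1 - real (length Fs') * (c * (9 / 10 * \<epsilon>) - \<eta>)"
    unfolding Fs c_def \<eta>_def
    using chain' \<gamma> lr0 lr(2) \<theta> c bad
    by (intro good_chain_dist2) (auto simp: Fs c_def less_imp_le)
  moreover have "0 < k\<^sup>2" using k_pos by simp
  \<comment> \<open>The unproven gain of one step (\<open>23/40 * q\<close>) and the loss
    \<open>\<eta> \<le> q / 10\<close> leave \<open>27/40 * q\<close>. The contradiction is thus not
    a negative distance but a last iterate so close to \<open>P\<close> that its error is below
    \<open>9/10 * \<epsilon>\<close>.\<close>
  ultimately have "dist2 (last Fs) \<le> q * (27 / 40)"
    using F1 gain_total \<eta> by linarith
  then have "L\<^sup>2 * dist2 (last Fs) \<le> L\<^sup>2 * (q * (27 / 40))"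
    by (intro mult_left_mono) auto
  also have "\<dots> = \<epsilon> * \<epsilon> * (27 / 40)" using L_pos by (simp add: q_def power2_eq_square)
  also have "\<dots> \<le> \<epsilon> * 1 * (27 / 40)" using \<epsilon> by (intro mult_right_mono mult_left_mono) auto
  finally have "err n u P (last Fs) \<le> \<epsilon> * (27 / 40)"
    using err_le_dist2[of "last Fs"] by simp
  then show False using bad[of "last Fs"] ne \<epsilon> by simp
qed

end

section \<open>Success probability and running time\<close>

lemma arg_min_list_le: "F \<in> set Fs \<Longrightarrow> f (arg_min_list f Fs) \<le> f F" for f :: "'b \<Rightarrow> real"
  by (subst f_arg_min_list_f) (auto intro: Min_le)

text \<open>Here \<open>\<delta>\<close> belongs to a single call of \<open>KM\<close>. One number
  \<open>N\<close> bounds both the time of a call and the support of its output, and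
  \<open>1\<close> and \<open>k\<close> are the two norm bounds that \<open>kmtron_step\<close>
  passes.\<close>

locale glm_KM = glm n u P k L
  for n u P k L +
  fixes KM :: km_procedure and \<gamma> \<theta> \<delta> :: real and N :: nat
  assumes KM_recovers: "\<And>B Q. B \<in> {1, k} \<Longrightarrow> L2 n Q \<le> B \<Longrightarrow>
      measure_pmf.prob (result Q (KM n B \<theta> \<delta>)) (- {Q'. recovers n \<gamma> \<theta> Q Q'}) \<le> \<delta>"
    and KM_terminates: "\<And>B Q. B \<in> {1, k} \<Longrightarrow> L2 n Q \<le> B \<Longrightarrow>
      terminates_in Q (KM n B \<theta> \<delta>) N {Q'. card (supp n Q') \<le> N}"
    and \<delta>_nonneg: "0 \<le> \<delta>"
begin

abbreviation target :: "point \<Rightarrow> real" where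
  "target \<equiv> \<lambda>x. u (P x)"

abbreviation residual :: "(point \<Rightarrow> real) \<Rightarrow> point \<Rightarrow> real" where
  "residual F \<equiv> \<lambda>x. u (P x) - u (F x)"

lemma L2_residual: "L2 n (residual F) \<le> 1"
proof -
  have "(L2 n (residual F))\<^sup>2 \<le> 1\<^sup>2"
    unfolding L2_squared using expect_mono[of n _ "\<lambda>_. 1"] residual_sq_bounds by simp
  then show ?thesis by (rule power2_le_imp_le) simp
qed

lemma L2_proj_K: "L2 n (proj_K n k F) \<le> k"
  by (rule order_trans[OF L2_le_L1 proj_K_in_ball]) (use k_pos in simp)

section \<open>Failure probability of the iterations\<close>

lemma run_residual_oracle:
  "run target (residual_oracle n u F x) = return_pmf (residual F x, 1 + eval_cost n F)"
  by (simp add: residual_oracle_def query_def spend_def)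

lemma run_explicit_oracle: "run f (explicit_oracle n F x) = return_pmf (F x, eval_cost n F)"
  by (simp add: explicit_oracle_def spend_def)

text \<open>Both oracles answer deterministically, so the simulation disappears from the
  distribution of results and the guarantee of \<open>KM\<close> applies to each call.\<close>

lemma result_kmtron_step:
  "result target (kmtron_step KM n u k lr \<theta> \<delta> F) =
    bind_pmf (result (residual F) (KM n 1 \<theta> \<delta>))
      (\<lambda>R. result (proj_K n k (\<lambda>x. F x + lr * R x)) (KM n k \<theta> \<delta>))"
proof -
  have "result target (residual_oracle n u G x) = return_pmf (residual G x)" for G x
    by (simp add: result_def run_residual_oracle)
  moreover have "result target (explicit_oracle n G x) = return_pmf (G x)" for G x
    by (simp add: result_def run_explicit_oracle)
  ultimately show ?thesis
    unfolding kmtron_step_def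
    by (simp add: result_bind_prog result_simulate spend_def Let_def)
qed

lemma prob_bad_step:
  "measure_pmf.prob (result target (kmtron_step KM n u k lr \<theta> \<delta> F))
    (- {F'. good_step \<gamma> \<theta> lr F F'}) \<le> \<delta> + \<delta>"
  unfolding result_kmtron_step
proof (rule prob_bind_pmf_le[OF KM_recovers \<delta>_nonneg])
  fix R assume R: "R \<in> {R. recovers n \<gamma> \<theta> (residual F) R}"
  let ?Q = "proj_K n k (\<lambda>x. F x + lr * R x)"
  have "measure_pmf.prob (result ?Q (KM n k \<theta> \<delta>)) (- {F'. good_step \<gamma> \<theta> lr F F'}) \<le>
      measure_pmf.prob (result ?Q (KM n k \<theta> \<delta>)) (- {F'. recovers n \<gamma> \<theta> ?Q F'})"
    using R by (intro measure_pmf.finite_measure_mono) (auto simp: good_step_def)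
  also have "\<dots> \<le> \<delta>" by (rule KM_recovers) (simp_all add: L2_proj_K)
  finally show "measure_pmf.prob (result ?Q (KM n k \<theta> \<delta>)) (- {F'. good_step \<gamma> \<theta> lr F F'}) \<le> \<delta>" .
qed (simp_all add: L2_residual)

lemma length_iterates:
  "Fs \<in> set_pmf (result f (iterates KM n u k lr \<theta> \<delta> T F)) \<Longrightarrow> length Fs = T"
  by (induction T arbitrary: F Fs) (auto simp: result_bind_prog)

text \<open>Keeping the start \<open>F\<close> as head of the chain makes the first step count and
  gives an induction over arbitrary starts.\<close>

lemma prob_bad_iterates:
  "measure_pmf.prob (result target (iterates KM n u k lr \<theta> \<delta> T F))
    (- {Fs. successively (good_step \<gamma> \<theta> lr) (F # Fs)}) \<le> real T * (2 * \<delta>)"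
proof (induction T arbitrary: F)
  case (Suc T)
  have "measure_pmf.prob (result target (iterates KM n u k lr \<theta> \<delta> (Suc T) F))
      (- {Fs. successively (good_step \<gamma> \<theta> lr) (F # Fs)}) \<le> (\<delta> + \<delta>) + real T * (2 * \<delta>)"
    unfolding iterates.simps result_bind_prog
  proof (rule prob_bind_pmf_le[OF prob_bad_step])
    fix F' assume F': "F' \<in> {F'. good_step \<gamma> \<theta> lr F F'}"
    have "measure_pmf.prob (map_pmf ((#) F') (result target (iterates KM n u k lr \<theta> \<delta> T F')))
        (- {Fs. successively (good_step \<gamma> \<theta> lr) (F # Fs)}) \<le>
      measure_pmf.prob (result target (iterates KM n u k lr \<theta> \<delta> T F'))
        (- {Fs. successively (good_step \<gamma> \<theta> lr) (F' # Fs)})"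
      using F' by (subst measure_map_pmf, intro measure_pmf.finite_measure_mono) auto
    also have "\<dots> \<le> real T * (2 * \<delta>)" by (rule Suc.IH)
    finally show "measure_pmf.prob (bind_pmf (result target (iterates KM n u k lr \<theta> \<delta> T F'))
        (\<lambda>Fs. result target (Return (F' # Fs)))) (- {Fs. successively (good_step \<gamma> \<theta> lr) (F # Fs)})
        \<le> real T * (2 * \<delta>)"
      by (simp add: map_pmf_def)
  qed (use \<delta>_nonneg in simp)
  then show ?case by (simp add: distrib_right)
qed simp

section \<open>Choosing an iterate from samples\<close>

lemma prob_misleading_sample:
  assumes "0 < s" "0 < m"
  shows "measure_pmf.prob (result target (labelled_sample n m))
      {zs. s \<le> \<bar>empirical_err u zs F - err n u P F\<bar>} \<le> 2 * exp (- 2 * real m * s\<^sup>2)"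
proof -
  let ?M = "result target (labelled_sample n m)"
  define g where "g = (\<lambda>(x, y). (y - u (F x))\<^sup>2)"
  have emp: "empirical_err u zs F = (\<Sum>z\<leftarrow>zs. g z) / real (length zs)" for zs
    by (simp add: empirical_err_def g_def)
  have g: "expect n (\<lambda>x. g (x, target x)) = err n u P F"
    "expect n (\<lambda>x. - g (x, target x)) = - err n u P F"
    using expect_cmult[of n "-1" "\<lambda>x. g (x, target x)"] by (simp_all add: err_def g_def)
  \<comment> \<open>The two-sided deviation splits into upper tails of \<open>g\<close>, with values
    in \<open>{0..1}\<close>, and of \<open>- g\<close>, with values in
    \<open>{-1..0}\<close>.\<close>
  have "measure_pmf.prob ?M {zs. s \<le> \<bar>empirical_err u zs F - err n u P F\<bar>} \<le>
      measure_pmf.prob ?M ({zs. err n u P F + s \<le> (\<Sum>z\<leftarrow>zs. g z) / real (length zs)} \<union>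
        {zs. - err n u P F + s \<le> (\<Sum>z\<leftarrow>zs. - g z) / real (length zs)})"
    by (intro measure_pmf.finite_measure_mono) (auto simp: emp uminus_sum_list_map[unfolded o_def, symmetric] abs_if split: if_splits)
  also have "\<dots> \<le> measure_pmf.prob ?M {zs. err n u P F + s \<le> (\<Sum>z\<leftarrow>zs. g z) / real (length zs)} +
        measure_pmf.prob ?M {zs. - err n u P F + s \<le> (\<Sum>z\<leftarrow>zs. - g z) / real (length zs)}"
    by (rule measure_Un_le) auto
  also have "measure_pmf.prob ?M {zs. err n u P F + s \<le> (\<Sum>z\<leftarrow>zs. g z) / real (length zs)}
      \<le> exp (- 2 * real m * s\<^sup>2)"
    using labelled_sample_tail[of n g target 0 s m] assms residual_sq_bounds
    unfolding g by (simp add: g_def)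
  also have "measure_pmf.prob ?M {zs. - err n u P F + s \<le> (\<Sum>z\<leftarrow>zs. - g z) / real (length zs)}
      \<le> exp (- 2 * real m * s\<^sup>2)"
    using labelled_sample_tail[of n "\<lambda>z. - g z" target "-1" s m] assms residual_sq_bounds
    unfolding g by (simp add: g_def)
  finally show ?thesis by simp
qed

text \<open>The union bound concerns a list fixed before the sample. This fits
  \<open>kmtron\<close>, which samples only after all iterates are known.\<close>

lemma prob_misleading_sample_list:
  assumes "0 < s" "0 < m"
  shows "measure_pmf.prob (result target (labelled_sample n m))
      {zs. \<exists>F\<in>set Fs. s \<le> \<bar>empirical_err u zs F - err n u P F\<bar>}
    \<le> real (length Fs) * (2 * exp (- 2 * real m * s\<^sup>2))"
proof -
  let ?M = "result target (labelled_sample n m)"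
  let ?E = "\<lambda>F. {zs. s \<le> \<bar>empirical_err u zs F - err n u P F\<bar>}"
  have "measure_pmf.prob ?M {zs. \<exists>F\<in>set Fs. s \<le> \<bar>empirical_err u zs F - err n u P F\<bar>} =
      measure_pmf.prob ?M (\<Union>F\<in>set Fs. ?E F)"
    by (rule arg_cong[where f = "measure_pmf.prob ?M"]) auto
  also have "\<dots> \<le> (\<Sum>F\<in>set Fs. measure_pmf.prob ?M (?E F))"
    by (rule measure_pmf.finite_measure_subadditive_finite) auto
  also have "\<dots> \<le> (\<Sum>F\<in>set Fs. 2 * exp (- 2 * real m * s\<^sup>2))"
    by (intro sum_mono prob_misleading_sample assms)
  also have "\<dots> = real (card (set Fs)) * (2 * exp (- 2 * real m * s\<^sup>2))" by simp
  also have "\<dots> \<le> real (length Fs) * (2 * exp (- 2 * real m * s\<^sup>2))"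
    by (intro mult_right_mono) (auto simp: card_length)
  finally show ?thesis .
qed

text \<open>The slack \<open>\<epsilon> / 10\<close> pays for two deviations of
  \<open>\<epsilon> / 20\<close>: that of the good iterate and that of the selected one.\<close>

lemma selection:
  assumes good: "F \<in> set Fs" "err n u P F \<le> 9 / 10 * \<epsilon>"
    and close: "\<And>G. G \<in> set Fs \<Longrightarrow> \<bar>empirical_err u zs G - err n u P G\<bar> < \<epsilon> / 20"
    and \<epsilon>: "0 < \<epsilon>"
  shows "err n u P (best_iterate n u P Fs) \<le> \<epsilon>"
    and "err n u P (arg_min_list (empirical_err u zs) Fs) \<le> \<epsilon>"
proof -
  show "err n u P (best_iterate n u P Fs) \<le> \<epsilon>"
    unfolding best_iterate_def
    using arg_min_list_le[OF good(1), of "err n u P"] good(2) \<epsilon> by simp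
  have "arg_min_list (empirical_err u zs) Fs \<in> set Fs"
    using good(1) by (intro arg_min_list_in) auto
  then show "err n u P (arg_min_list (empirical_err u zs) Fs) \<le> \<epsilon>"
    using arg_min_list_le[OF good(1), of "empirical_err u zs"] close[OF good(1)]
      close[of "arg_min_list (empirical_err u zs) Fs"] good(2) by linarith
qed

lemma result_kmtron:
  "result f (kmtron KM n u k lr T \<theta> \<delta> m) =
    bind_pmf (result f (iterates KM n u k lr \<theta> \<delta> T (\<lambda>_. 0))) (\<lambda>Fs.
      map_pmf (\<lambda>zs. (Fs, arg_min_list (empirical_err u zs) Fs)) (result f (labelled_sample n m)))"
  unfolding kmtron_def by (simp add: result_bind_prog spend_def map_pmf_def)

lemma prob_kmtron_failure:
  assumes "0 < \<gamma>" "0 < \<theta>" "0 < \<epsilon>" "\<epsilon> < 1" "lr = \<epsilon> / (2 * L)" "lr \<le> 1" "0 < T" "0 < m"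
    and T: "2 * k\<^sup>2 * L\<^sup>2 / \<epsilon>\<^sup>2 \<le> real T"
    and "\<theta> \<le> 9 / (100 * (8 + 1 / \<gamma>) * (2 + 1 / \<gamma>)\<^sup>2) * \<epsilon> ^ 4 / (L ^ 4 * k ^ 3)"
  shows "measure_pmf.prob (result target (kmtron KM n u k lr T \<theta> \<delta> m))
      (- {(Fs, F). err n u P (best_iterate n u P Fs) \<le> \<epsilon> \<and> err n u P F \<le> \<epsilon>})
    \<le> real T * (2 * \<delta>) + real T * (2 * exp (- 2 * real m * (\<epsilon> / 20)\<^sup>2))"
  unfolding result_kmtron
proof (rule prob_bind_pmf_le[OF prob_bad_iterates])
  fix Fs assume Fs: "Fs \<in> set_pmf (result target (iterates KM n u k lr \<theta> \<delta> T (\<lambda>_. 0)))"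
    and chain: "Fs \<in> {Fs. successively (good_step \<gamma> \<theta> lr) ((\<lambda>_. 0) # Fs)}"
  let ?M = "result target (labelled_sample n m)"
  have len: "length Fs = T" using Fs by (rule length_iterates)
  then have "Fs \<noteq> []" using assms(7) by auto
  then obtain F where F: "F \<in> set Fs" "err n u P F \<le> 9 / 10 * \<epsilon>"
    using ex_good_iterate[of \<gamma> \<theta> lr Fs \<epsilon>] chain assms len by auto
  have "measure_pmf.prob (map_pmf (\<lambda>zs. (Fs, arg_min_list (empirical_err u zs) Fs)) ?M)
      (- {(Fs, F). err n u P (best_iterate n u P Fs) \<le> \<epsilon> \<and> err n u P F \<le> \<epsilon>}) \<le>
    measure_pmf.prob ?M {zs. \<exists>F\<in>set Fs. \<epsilon> / 20 \<le> \<bar>empirical_err u zs F - err n u P F\<bar>}"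
  proof (subst measure_map_pmf, intro measure_pmf.finite_measure_mono subsetI CollectI)
    fix zs
    assume bad: "zs \<in> (\<lambda>zs. (Fs, arg_min_list (empirical_err u zs) Fs)) -`
      (- {(Fs, F). err n u P (best_iterate n u P Fs) \<le> \<epsilon> \<and> err n u P F \<le> \<epsilon>})"
    show "\<exists>F\<in>set Fs. \<epsilon> / 20 \<le> \<bar>empirical_err u zs F - err n u P F\<bar>"
      using selection[OF F, of zs] bad \<open>0 < \<epsilon>\<close> by force
  qed simp
  also have "\<dots> \<le> real T * (2 * exp (- 2 * real m * (\<epsilon> / 20)\<^sup>2))"
    using prob_misleading_sample_list[of "\<epsilon> / 20" m Fs] assms len by simp
  finally show "measure_pmf.prob (map_pmf (\<lambda>zs. (Fs, arg_min_list (empirical_err u zs) Fs)) ?M)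
      (- {(Fs, F). err n u P (best_iterate n u P Fs) \<le> \<epsilon> \<and> err n u P F \<le> \<epsilon>})
    \<le> real T * (2 * exp (- 2 * real m * (\<epsilon> / 20)\<^sup>2))" .
qed simp

section \<open>Running time\<close>

lemma terminates_in_kmtron_step:
  assumes F: "card (supp n F) \<le> N"
  shows "terminates_in target (kmtron_step KM n u k lr \<theta> \<delta> F)
    (10 * (n + 1) * (N + 1)\<^sup>2) {F'. card (supp n F') \<le> N}"
proof -
  \<comment> \<open>Bounds the evaluation cost of a function with at most \<open>N\<close>
    coefficients. Adding \<open>lr * R\<close> can double the support and the projection does not
    enlarge it, hence the factors 2 below; the second \<open>KM\<close> call restores the bound
    \<open>N\<close>.\<close>
  define E where "E = (n + 1) * (N + 1)"
  have eval: "eval_cost n G \<le> E" if "card (supp n G) \<le> N" for G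
    using that by (simp add: eval_cost_def E_def del: mult_Suc mult_Suc_right)
  have R: "terminates_in target (simulate (residual_oracle n u F) (KM n 1 \<theta> \<delta>))
      (N * (1 + eval_cost n F)) {R. card (supp n R) \<le> N}"
    by (rule terminates_in_simulate[OF run_residual_oracle])
       (auto intro: KM_terminates L2_residual)
  have "terminates_in target (kmtron_step KM n u k lr \<theta> \<delta> F)
      (N * (1 + eval_cost n F) + (2 * E + (4 * E * (N + 1) + N * (2 * E)))) {F'. card (supp n F') \<le> N}"
    unfolding kmtron_step_def
  proof (rule terminates_in_bind[OF R])
    fix R assume "R \<in> {R. card (supp n R) \<le> N}"
    then have R: "card (supp n R) \<le> N" by simp
    let ?F' = "\<lambda>x. F x + lr * R x"
    have "card (supp n ?F') \<le> card (supp n F \<union> supp n R)"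
      by (intro card_mono supp_add_cmult) simp
    also have "\<dots> \<le> 2 * N"
      using card_Un_le[of "supp n F" "supp n R"] F R by simp
    finally have F': "card (supp n ?F') \<le> 2 * N" .
    have "(1 + card (supp n ?F'))\<^sup>2 \<le> (2 * (N + 1))\<^sup>2"
      using F' by (intro power_mono) auto
    then have "proj_cost n ?F' \<le> (n + 1) * (2 * (N + 1))\<^sup>2"
      unfolding proj_cost_def by (intro mult_le_mono2)
    also have "\<dots> = 4 * E * (N + 1)" by (simp add: E_def power2_eq_square algebra_simps)
    finally have proj: "proj_cost n ?F' \<le> 4 * E * (N + 1)" .
    have "card (supp n (proj_K n k ?F')) \<le> 2 * N"
      using card_mono[OF finite_supp supp_proj_K[of k n ?F']] F' k_pos by simp
    then have "eval_cost n (proj_K n k ?F') \<le> (n + 1) * (2 * (N + 1))"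
      unfolding eval_cost_def by (intro mult_le_mono2) simp
    also have "\<dots> = 2 * E" by (simp add: E_def)
    finally have Q: "eval_cost n (proj_K n k ?F') \<le> 2 * E" .
    have Q': "terminates_in target (simulate (explicit_oracle n (proj_K n k ?F')) (KM n k \<theta> \<delta>))
        (N * (2 * E)) {F'. card (supp n F') \<le> N}"
    proof (rule terminates_in_mono)
      show "terminates_in target (simulate (explicit_oracle n (proj_K n k ?F')) (KM n k \<theta> \<delta>))
          (N * eval_cost n (proj_K n k ?F')) {F'. card (supp n F') \<le> N}"
        by (rule terminates_in_simulate[OF run_explicit_oracle])
           (auto intro: KM_terminates L2_proj_K simp: eval_cost_def)
    qed (use Q in auto)
    have "terminates_in target (spend (eval_cost n F + eval_cost n R)) (2 * E) UNIV"
      using eval[OF F] eval[OF R] by (intro terminates_in_mono[OF terminates_in_spend]) auto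
    moreover have "terminates_in target (spend (proj_cost n ?F')) (4 * E * (N + 1)) UNIV"
      using proj by (intro terminates_in_mono[OF terminates_in_spend]) auto
    ultimately show "terminates_in target
       (bind_prog (spend (eval_cost n F + eval_cost n R)) (\<lambda>_. let F' = ?F' in
          bind_prog (spend (proj_cost n F')) (\<lambda>_.
          simulate (explicit_oracle n (proj_K n k F')) (KM n k \<theta> \<delta>))))
       (2 * E + (4 * E * (N + 1) + N * (2 * E))) {F'. card (supp n F') \<le> N}"
      unfolding Let_def using Q' by (intro terminates_in_bind)
  qed
  then show ?thesis
  proof (rule terminates_in_mono)
    \<comment> \<open>In units of \<open>E * (N + 1)\<close> the four costs are at most 2, 2, 4 and
      2.\<close>
    have "N * (1 + eval_cost n F) \<le> N * (2 * E)"
    proof (rule mult_le_mono2)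
      show "1 + eval_cost n F \<le> 2 * E" using eval[OF F] by (simp add: E_def)
    qed
    moreover have "2 * E \<le> 2 * (E * (N + 1))" "N * (2 * E) \<le> 2 * (E * (N + 1))" by simp_all
    moreover have "4 * E * (N + 1) = 4 * (E * (N + 1))" by (rule mult.assoc)
    moreover have "10 * (n + 1) * (N + 1)\<^sup>2 = 10 * (E * (N + 1))"
      by (simp add: E_def power2_eq_square algebra_simps)
    ultimately show "N * (1 + eval_cost n F) + (2 * E + (4 * E * (N + 1) + N * (2 * E)))
        \<le> 10 * (n + 1) * (N + 1)\<^sup>2"
      by linarith
  qed simp
qed

lemma terminates_in_iterates:
  assumes "card (supp n F) \<le> N"
  shows "terminates_in target (iterates KM n u k lr \<theta> \<delta> T F) (T * (10 * (n + 1) * (N + 1)\<^sup>2))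
    {Fs. length Fs = T \<and> (\<forall>F\<in>set Fs. card (supp n F) \<le> N)}"
  using assms
proof (induction T arbitrary: F)
  case (Suc T)
  let ?c = "10 * (n + 1) * (N + 1)\<^sup>2"
  have "terminates_in target (iterates KM n u k lr \<theta> \<delta> (Suc T) F) (?c + (T * ?c + 0))
      {Fs. length Fs = Suc T \<and> (\<forall>F\<in>set Fs. card (supp n F) \<le> N)}"
    unfolding iterates.simps
    by (rule terminates_in_bind[OF terminates_in_kmtron_step[OF Suc.prems]])
       (rule terminates_in_bind[OF Suc.IH], auto simp: terminates_in_def)
  then show ?case by simp
qed (simp add: terminates_in_Return)

lemma terminates_in_kmtron:
  "terminates_in target (kmtron KM n u k lr T \<theta> \<delta> m)
    (12 * (n + 1) * (N + 1)\<^sup>2 * (T + 1) * (m + 1)) UNIV"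
proof -
  \<comment> \<open>A crude common unit: it dominates the cost \<open>n + 1\<close> of an example
    and the evaluation cost of an iterate.\<close>
  define W where "W = (n + 1) * (N + 1)\<^sup>2"
  have "terminates_in target (kmtron KM n u k lr T \<theta> \<delta> m)
      (T * (10 * (n + 1) * (N + 1)\<^sup>2) + (m * (n + 1) + (T * (1 + m * W) + 0))) UNIV"
    unfolding kmtron_def
  proof (rule terminates_in_bind[OF terminates_in_iterates],
      simp, rule terminates_in_bind[OF terminates_in_labelled_sample])
    fix Fs zs
    assume Fs: "Fs \<in> {Fs. length Fs = T \<and> (\<forall>F\<in>set Fs. card (supp n F) \<le> N)}"
    have "eval_cost n F \<le> W" if "F \<in> set Fs" for F
    proof -
      have "1 + card (supp n F) \<le> (N + 1) * (N + 1)" using Fs that by (auto intro: le_SucI trans_le_add1)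
      then show ?thesis unfolding eval_cost_def W_def power2_eq_square by (rule mult_le_mono2)
    qed
    then have "(\<Sum>F\<leftarrow>Fs. 1 + m * eval_cost n F) \<le> (\<Sum>F\<leftarrow>Fs. 1 + m * W)"
      by (intro sum_list_mono add_left_mono mult_le_mono2)
    also have "\<dots> = T * (1 + m * W)" using Fs by (simp add: sum_list_triv)
    finally have cost: "(\<Sum>F\<leftarrow>Fs. 1 + m * eval_cost n F) \<le> T * (1 + m * W)" .
    show "terminates_in target (bind_prog (spend (\<Sum>F\<leftarrow>Fs. 1 + m * eval_cost n F))
        (\<lambda>_. Return (Fs, arg_min_list (empirical_err u zs) Fs))) (T * (1 + m * W) + 0) UNIV"
      by (rule terminates_in_bind[OF terminates_in_mono[OF terminates_in_spend cost subset_refl]])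
         (rule terminates_in_Return UNIV_I)+
  qed
  then show ?thesis
  proof (rule terminates_in_mono)
    have "1 \<le> (N + 1)\<^sup>2" by (rule one_le_power) simp
    from mult_le_mono2[OF this, of "n + 1"] have "n + 1 \<le> W"
      by (simp only: W_def mult_1_right)
    then have W: "1 \<le> W" "n + 1 \<le> W" by simp_all
    have "T * (10 * W) + (m * (n + 1) + (T * (1 + m * W) + 0)) \<le> T * (10 * W) + (m * W + (T * (W + m * W) + 0))"
      using W by (intro add_mono mult_le_mono) auto
    also have "\<dots> \<le> 12 * W * (T + 1) * (m + 1)" by (simp add: algebra_simps)
    finally show "T * (10 * (n + 1) * (N + 1)\<^sup>2) + (m * (n + 1) + (T * (1 + m * W) + 0))
        \<le> 12 * (n + 1) * (N + 1)\<^sup>2 * (T + 1) * (m + 1)"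
      by (simp only: W_def mult.assoc)
  qed simp
qed

end

text \<open>\<open>\<gamma>\<close>, \<open>A\<close> and \<open>d\<close> are chosen before all
  parameters, so \<open>C'\<close> can be fixed in advance. Passing to \<open>\<bar>a\<bar>\<close>
  makes the time bound monotone in its base, and \<open>< real N + 1\<close> admits an
  \<open>N\<close> obtained by rounding down.\<close>

lemma is_KM_recovers_terminates:
  assumes "is_KM KM"
  shows "\<exists>(\<gamma>::real) (A::real) (d::nat). 0 < \<gamma> \<and> 0 \<le> A \<and>
    (\<forall>n B \<theta> \<delta> Q. 0 < B \<longrightarrow> 0 < \<theta> \<longrightarrow> 0 < \<delta> \<longrightarrow> \<delta> < 1 \<longrightarrow> L2 n Q \<le> B \<longrightarrow>
      measure_pmf.prob (result Q (KM n B \<theta> \<delta>)) (- {Q'. recovers n \<gamma> \<theta> Q Q'}) \<le> \<delta> \<and>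
      (\<forall>N. A * (1 + real n + 1/\<theta> + B + ln (1/\<delta>)) ^ d < real N + 1 \<longrightarrow>
        terminates_in Q (KM n B \<theta> \<delta>) N {Q'. card (supp n Q') \<le> N}))"
proof -
  from assms obtain c \<gamma> a :: real and d :: nat where \<gamma>: "0 < \<gamma>" and
    KM: "\<forall>n B \<theta> \<delta> Q. 0 < B \<longrightarrow> 0 < \<theta> \<longrightarrow> 0 < \<delta> \<longrightarrow> \<delta> < 1 \<longrightarrow> L2 n Q \<le> B \<longrightarrow>
        1 - \<delta> \<le> measure_pmf.prob (run Q (KM n B \<theta> \<delta>))
          {(Q', t). real (card (supp n Q')) \<le> c * (L2 n Q)\<^sup>2 / \<theta>\<^sup>2 \<and>
                    Linf n (\<lambda>x. Q x - Q' x) \<le> \<theta> \<and>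
                    (\<forall>S\<in>supp n Q'. \<gamma> * \<theta> \<le> \<bar>fourier n Q S\<bar>)} \<and>
        (\<forall>(Q', t)\<in>set_pmf (run Q (KM n B \<theta> \<delta>)).
           real t \<le> a * (1 + real n + 1/\<theta> + B + ln (1/\<delta>)) ^ d \<and> card (supp n Q') \<le> t)"
    unfolding is_KM_def by blast
  have "measure_pmf.prob (result Q (KM n B \<theta> \<delta>)) (- {Q'. recovers n \<gamma> \<theta> Q Q'}) \<le> \<delta> \<and>
      (\<forall>N. \<bar>a\<bar> * (1 + real n + 1/\<theta> + B + ln (1/\<delta>)) ^ d < real N + 1 \<longrightarrow>
        terminates_in Q (KM n B \<theta> \<delta>) N {Q'. card (supp n Q') \<le> N})"
    if *: "0 < B" "0 < \<theta>" "0 < \<delta>" "\<delta> < 1" "L2 n Q \<le> B" for n B \<theta> \<delta> Q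
  proof (intro conjI allI impI)
    note KM = KM[rule_format, OF *]
    let ?M = "run Q (KM n B \<theta> \<delta>)"
    have "1 - \<delta> \<le> measure_pmf.prob ?M (fst -` {Q'. recovers n \<gamma> \<theta> Q Q'})"
      by (rule order_trans[OF conjunct1[OF KM]], rule measure_pmf.finite_measure_mono)
         (auto simp: recovers_def)
    also have "\<dots> = measure_pmf.prob (result Q (KM n B \<theta> \<delta>)) {Q'. recovers n \<gamma> \<theta> Q Q'}"
      by (simp add: result_def)
    finally show "measure_pmf.prob (result Q (KM n B \<theta> \<delta>)) (- {Q'. recovers n \<gamma> \<theta> Q Q'}) \<le> \<delta>"
      using measure_pmf.prob_compl[of "{Q'. recovers n \<gamma> \<theta> Q Q'}" "result Q (KM n B \<theta> \<delta>)"]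
      by (simp add: Compl_eq_Diff_UNIV)
    fix N
    assume N: "\<bar>a\<bar> * (1 + real n + 1/\<theta> + B + ln (1/\<delta>)) ^ d < real N + 1"
    have "0 \<le> ln (1/\<delta>)" using * by simp
    then have "a * (1 + real n + 1/\<theta> + B + ln (1/\<delta>)) ^ d \<le>
        \<bar>a\<bar> * (1 + real n + 1/\<theta> + B + ln (1/\<delta>)) ^ d"
      using * by (intro mult_right_mono zero_le_power) auto
    then have "t \<le> N" if "real t \<le> a * (1 + real n + 1/\<theta> + B + ln (1/\<delta>)) ^ d" for t
      using that N by linarith
    then show "terminates_in Q (KM n B \<theta> \<delta>) N {Q'. card (supp n Q') \<le> N}"
      using conjunct2[OF KM] unfolding terminates_in_def by fastforce
  qed
  then show ?thesis using \<gamma> by (intro exI[of _ \<gamma>] exI[of _ "\<bar>a\<bar>"] exI[of _ d]) simp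
qed

section \<open>Numerical estimates for the parameters\<close>

lemma kmtron_parameter_bounds:
  fixes k L \<epsilon> \<delta> X :: real
  assumes X: "1 \<le> X" "k \<le> X" "L \<le> X" "1 / \<epsilon> \<le> X" "ln (1 / \<delta>) \<le> X"
    and pos: "0 < k" "0 < L" "0 < \<epsilon>" "0 < \<delta>" "\<delta> < 1"
  defines "T \<equiv> nat \<lceil>2 * k\<^sup>2 * L\<^sup>2 / \<epsilon>\<^sup>2\<rceil>"
  defines "m \<equiv> nat \<lceil>400 * ln (4 * real T / \<delta>) / \<epsilon>\<^sup>2\<rceil>"
  shows "0 < T" "real T + 1 \<le> 4 * X ^ 6" "ln (4 * real T / \<delta>) \<le> 13 * X ^ 6" "0 < m"
    "real m + 1 \<le> 5202 * X ^ 8"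
proof -
  have X_pow: "1 \<le> X ^ i" "X \<le> X ^ Suc i" for i
    using X(1) mult_left_mono[of 1 "X ^ i" X] by (simp_all add: one_le_power)
  have "0 < 2 * k\<^sup>2 * L\<^sup>2 / \<epsilon>\<^sup>2" using pos by simp
  then show T0: "0 < T" by (simp add: T_def)
  have "k * L * (1 / \<epsilon>) \<le> X * X * X"
    using X pos by (intro mult_mono) auto
  then have "(k * L * (1 / \<epsilon>))\<^sup>2 \<le> (X * X * X)\<^sup>2"
    using pos by (intro power_mono) auto
  also have "(k * L * (1 / \<epsilon>))\<^sup>2 = k\<^sup>2 * L\<^sup>2 / \<epsilon>\<^sup>2"
    by (simp add: power_mult_distrib power_divide)
  also have "(X * X * X)\<^sup>2 = X ^ 6" by (simp add: eval_nat_numeral)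
  finally have "2 * k\<^sup>2 * L\<^sup>2 / \<epsilon>\<^sup>2 \<le> 2 * X ^ 6" by simp
  moreover have "real T \<le> 2 * k\<^sup>2 * L\<^sup>2 / \<epsilon>\<^sup>2 + 1"
    using \<open>0 < 2 * k\<^sup>2 * L\<^sup>2 / \<epsilon>\<^sup>2\<close> unfolding T_def by linarith
  ultimately have T: "real T \<le> 3 * X ^ 6" using X_pow(1)[of 6] by linarith
  then show "real T + 1 \<le> 4 * X ^ 6" using X_pow(1)[of 6] by linarith
  have q: "1 < 4 * real T / \<delta>" using T0 pos by (simp add: field_simps)
  have "ln (4 * real T / \<delta>) = ln (4 * real T) + ln (1 / \<delta>)"
    using T0 pos by (simp add: ln_div)
  \<comment> \<open>A crude bound on the logarithm is enough for a polynomial.\<close>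
  also have "ln (4 * real T) \<le> 4 * real T"
    using T0 by (intro order_trans[OF ln_le_minus_one]) auto
  finally have "ln (4 * real T / \<delta>) \<le> 4 * real T + ln (1 / \<delta>)" by simp
  then show ln_le: "ln (4 * real T / \<delta>) \<le> 13 * X ^ 6"
    using T X(5) X_pow(2)[of 5] by simp
  have pos_m: "0 < 400 * ln (4 * real T / \<delta>) / \<epsilon>\<^sup>2" using q pos by simp
  then show "0 < m" by (simp add: m_def)
  have "real m \<le> 400 * ln (4 * real T / \<delta>) / \<epsilon>\<^sup>2 + 1"
    using pos_m unfolding m_def by linarith
  also have "400 * ln (4 * real T / \<delta>) / \<epsilon>\<^sup>2 = 400 * ln (4 * real T / \<delta>) * (1 / \<epsilon>)\<^sup>2"
    by (simp add: power_divide)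
  also have "\<dots> \<le> 400 * (13 * X ^ 6) * X\<^sup>2"
    using ln_le X pos by (intro mult_mono mult_left_mono power_mono) auto
  also have "\<dots> = 5200 * X ^ 8" by (simp add: eval_nat_numeral)
  finally show "real m + 1 \<le> 5202 * X ^ 8" using X_pow(1)[of 8] by linarith
qed

text \<open>Degrees: 1 from \<open>n\<close>, \<open>12 * d\<close> from the square of
  \<open>N\<close>, 6 from \<open>T\<close>, 8 from \<open>m\<close>. The factor is
  \<open>12 * 4 * 5202\<close>.\<close>

lemma kmtron_time_bound:
  fixes X A :: real
  assumes X: "1 \<le> X" and A: "0 \<le> A" and n: "real n + 1 \<le> X"
    and N: "real N \<le> A * (15 * X ^ 6) ^ d"
    and T: "real T + 1 \<le> 4 * X ^ 6" and m: "real m + 1 \<le> 5202 * X ^ 8"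
  shows "real (12 * (n + 1) * (N + 1)\<^sup>2 * (T + 1) * (m + 1)) \<le>
    249696 * (A * 15 ^ d + 1)\<^sup>2 * X ^ (15 + 12 * d)"
proof -
  have "1 \<le> X ^ (6 * d)" using X by (rule one_le_power)
  then have N1: "real N + 1 \<le> (A * 15 ^ d + 1) * X ^ (6 * d)"
    using N by (simp add: power_mult_distrib power_mult distrib_right mult.assoc)
  have "real (12 * (n + 1) * (N + 1)\<^sup>2 * (T + 1) * (m + 1)) =
      12 * (real n + 1) * (real N + 1)\<^sup>2 * (real T + 1) * (real m + 1)"
    by (simp only: of_nat_mult of_nat_add of_nat_power of_nat_numeral of_nat_1)
  also have "\<dots> \<le> 12 * X * ((A * 15 ^ d + 1) * X ^ (6 * d))\<^sup>2 * (4 * X ^ 6) * (5202 * X ^ 8)"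
    using n N1 T m X A by (intro mult_mono power_mono order_refl) auto
  also have "\<dots> = 249696 * (A * 15 ^ d + 1)\<^sup>2 * (X * (X ^ (6 * d))\<^sup>2 * X ^ 6 * X ^ 8)"
    by (simp add: power_mult_distrib)
  also have "X * (X ^ (6 * d))\<^sup>2 * X ^ 6 * X ^ 8 = X ^ (15 + 12 * d)"
    by (simp add: power_add[symmetric] power_mult[symmetric] power_Suc[symmetric] del: power_Suc)
  finally show ?thesis .
qed

text \<open>The \<open>2 * T\<close> calls of \<open>KM\<close> use up \<open>\<delta> / 2\<close>.
  For the sample, the 400 in \<open>m\<close> offsets \<open>(\<epsilon> / 20)\<^sup>2\<close> and
  the 2 in Hoeffding's exponent squares \<open>q\<close>, which leaves
  \<open>\<delta>\<^sup>2 / (8 * T)\<close>.\<close>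

lemma failure_budget:
  fixes \<delta> \<epsilon> :: real
  assumes "0 < T" "0 < \<delta>" "\<delta> < 1" "0 < \<epsilon>"
    and m: "400 * ln (4 * real T / \<delta>) / \<epsilon>\<^sup>2 \<le> real m"
  shows "real T * (2 * (\<delta> / (4 * real T))) + real T * (2 * exp (- 2 * real m * (\<epsilon> / 20)\<^sup>2)) \<le> \<delta>"
proof -
  define q where "q = 4 * real T / \<delta>"
  have q: "0 < q" using assms by (simp add: q_def)
  have "400 * ln q \<le> real m * \<epsilon>\<^sup>2" using m assms(4) by (simp add: q_def field_simps)
  then have "- 2 * real m * (\<epsilon> / 20)\<^sup>2 \<le> - 2 * ln q" by (simp add: power_divide)
  then have "exp (- 2 * real m * (\<epsilon> / 20)\<^sup>2) \<le> exp (- 2 * ln q)" by (simp only: exp_le_cancel_iff)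
  also have "\<dots> = 1 / q\<^sup>2"
    using q by (simp add: exp_minus exp_double inverse_eq_divide)
  finally have "real T * (2 * exp (- 2 * real m * (\<epsilon> / 20)\<^sup>2)) \<le> real T * (2 * (1 / q\<^sup>2))"
    by (intro mult_left_mono) auto
  also have "\<dots> = \<delta> / 2 * (\<delta> / (4 * real T))"
    using assms by (simp add: q_def power2_eq_square field_simps)
  also have "\<dots> \<le> \<delta> / 2 * 1"
    using assms by (intro mult_left_mono) (auto simp: field_simps)
  finally show ?thesis using assms by (simp add: field_simps)
qed

theorem theorem6:
  fixes KM :: km_procedure
  assumes "is_KM KM"
  shows "\<exists>C'>0. \<exists>(a::real) (d::nat). \<forall>(n::nat) (u::real \<Rightarrow> real) (P::point \<Rightarrow> real)
           (k::real) (L::real) (\<epsilon>::real) (\<theta>::real) (\<delta>::real) (lr::real) (T::nat) (m::nat).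
           mono u \<longrightarrow> L-lipschitz_on UNIV u \<longrightarrow> range u \<subseteq> {0..1} \<longrightarrow> L1 n P \<le> k \<longrightarrow>
           k > 0 \<longrightarrow> L > 0 \<longrightarrow> \<epsilon> > 0 \<longrightarrow> 0 < \<delta> \<longrightarrow> \<delta> < 1 \<longrightarrow>
           lr = \<epsilon> / (2 * L) \<longrightarrow> lr \<le> 1 \<longrightarrow>
           T = nat \<lceil>2 * k\<^sup>2 * L\<^sup>2 / \<epsilon>\<^sup>2\<rceil> \<longrightarrow>
           m = nat \<lceil>400 * ln (4 * real T / \<delta>) / \<epsilon>\<^sup>2\<rceil> \<longrightarrow>
           0 < \<theta> \<longrightarrow> \<theta> \<le> C' * \<epsilon>^4 / (L^4 * k^3) \<longrightarrow>
           (let out = run (\<lambda>x. u (P x)) (kmtron KM n u k lr T \<theta> (\<delta> / (4 * real T)) m) in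
              measure_pmf.prob out
                {((Fs, F), t). err n u P (best_iterate n u P Fs) \<le> \<epsilon> \<and> err n u P F \<le> \<epsilon>} \<ge> 1 - \<delta> \<and>
              (\<forall>((Fs, F), t)\<in>set_pmf out.
                 real t \<le> a * (1 + real n + k + L + 1/\<epsilon> + 1/\<theta> + ln (1/\<delta>)) ^ d) \<and>
              (\<theta> = C' * \<epsilon>^4 / (L^4 * k^3) \<longrightarrow>
                 (\<forall>((Fs, F), t)\<in>set_pmf out.
                    real t \<le> a * (1 + real n + k + L + 1/\<epsilon> + ln (1/\<delta>)) ^ d)))"
proof -
  from is_KM_recovers_terminates[OF assms]
  obtain \<gamma> A :: real and d :: nat where \<gamma>: "0 < \<gamma>" and A: "0 \<le> A"
    and KM: "\<forall>n B \<theta> \<delta> Q. 0 < B \<longrightarrow> 0 < \<theta> \<longrightarrow> 0 < \<delta> \<longrightarrow> \<delta> < 1 \<longrightarrow> L2 n Q \<le> B \<longrightarrow>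
      measure_pmf.prob (result Q (KM n B \<theta> \<delta>)) (- {Q'. recovers n \<gamma> \<theta> Q Q'}) \<le> \<delta> \<and>
      (\<forall>N. A * (1 + real n + 1/\<theta> + B + ln (1/\<delta>)) ^ d < real N + 1 \<longrightarrow>
        terminates_in Q (KM n B \<theta> \<delta>) N {Q'. card (supp n Q') \<le> N})"
    by blast
  define C' where "C' = 9 / (100 * (8 + 1 / \<gamma>) * (2 + 1 / \<gamma>)\<^sup>2)"
  define D where "D = 15 + 12 * d"
  define a0 where "a0 = 249696 * (A * 15 ^ d + 1)\<^sup>2"
  \<comment> \<open>The extra factor absorbs \<open>1 / \<theta>\<close> in the second time bound;
    it is at least 1, so one \<open>a\<close> serves both.\<close>
  define a where "a = a0 * (1 + 1 / C') ^ D"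
  have "0 < 8 + 1 / \<gamma>" "0 < 2 + 1 / \<gamma>" using \<gamma> by (simp_all add: add_pos_pos)
  then have C': "0 < C'" by (simp add: C'_def)
  have a0: "0 \<le> a0" by (simp add: a0_def)
  show ?thesis
  proof (rule exI[of _ C'], rule conjI[OF C'], rule exI[of _ a], rule exI[of _ "11 * D"],
      intro allI impI)
    fix n :: nat and u :: "real \<Rightarrow> real" and P :: "point \<Rightarrow> real"
      and k L \<epsilon> \<theta> \<delta> lr :: real and T m :: nat
    assume u: "mono u" "L-lipschitz_on UNIV u" "range u \<subseteq> {0..1}" "L1 n P \<le> k"
      and pos: "0 < k" "0 < L" "0 < \<epsilon>" "0 < \<delta>" "\<delta> < 1"
      and lr: "lr = \<epsilon> / (2 * L)" "lr \<le> 1"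
      and T: "T = nat \<lceil>2 * k\<^sup>2 * L\<^sup>2 / \<epsilon>\<^sup>2\<rceil>"
      and m: "m = nat \<lceil>400 * ln (4 * real T / \<delta>) / \<epsilon>\<^sup>2\<rceil>"
      and \<theta>: "0 < \<theta>" "\<theta> \<le> C' * \<epsilon> ^ 4 / (L ^ 4 * k ^ 3)"
    define \<delta>' where "\<delta>' = \<delta> / (4 * real T)"
    define Y where "Y = 1 + real n + k + L + 1 / \<epsilon> + ln (1 / \<delta>)"
    define X where "X = Y + 1 / \<theta>"
    define N where "N = nat \<lfloor>A * (15 * X ^ 6) ^ d\<rfloor>"
    have ln_\<delta>: "0 \<le> ln (1 / \<delta>)" using pos by simp
    have Y: "1 \<le> Y" "k \<le> Y" "L \<le> Y" "1 / \<epsilon> \<le> Y" "ln (1 / \<delta>) \<le> Y" "real n + 1 \<le> Y"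
      using pos ln_\<delta> by (simp_all add: Y_def)
    have X_ge: "Y \<le> X" using \<theta> by (simp add: X_def)
    then have X: "1 \<le> X" "k \<le> X" "L \<le> X" "1 / \<epsilon> \<le> X" "ln (1 / \<delta>) \<le> X" "real n + 1 \<le> X"
      using Y by linarith+
    note bounds = kmtron_parameter_bounds[OF X(1-5) pos, folded T, folded m]
    have \<delta>': "0 < \<delta>'" "\<delta>' < 1" using pos bounds(1) by (simp_all add: \<delta>'_def field_simps)
    have "ln (1 / \<delta>') \<le> 13 * X ^ 6" using bounds(3) by (simp add: \<delta>'_def)
    moreover have "X \<le> X ^ 6" "1 \<le> X ^ 6"
      using X(1) self_le_power[of X 6] one_le_power[of X 6] by simp_all
    moreover have "1 + real n + 1 / \<theta> + k \<le> X" using pos ln_\<delta> by (simp add: X_def Y_def)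
    \<comment> \<open>\<open>15 = 1 + 1 + 13\<close>: \<open>X\<close> itself, one more unit for the
      case \<open>B = 1\<close>, and the logarithm.\<close>
    ultimately have base: "1 + real n + 1 / \<theta> + B + ln (1 / \<delta>') \<le> 15 * X ^ 6" if "B \<in> {1, k}" for B
      using that pos by auto
    have N_le: "A * (1 + real n + 1 / \<theta> + B + ln (1 / \<delta>')) ^ d < real N + 1" if "B \<in> {1, k}" for B
    proof -
      have "0 \<le> ln (1 / \<delta>')" using \<delta>' by simp
      then have "A * (1 + real n + 1 / \<theta> + B + ln (1 / \<delta>')) ^ d \<le> A * (15 * X ^ 6) ^ d"
        using that pos \<theta> by (intro mult_left_mono power_mono base A) auto
      also have "\<dots> < real N + 1" unfolding N_def by linarith
      finally show ?thesis .
    qed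
    have "0 \<le> A * (15 * X ^ 6) ^ d" using A X by simp
    then have N: "real N \<le> A * (15 * X ^ 6) ^ d" unfolding N_def by linarith
    interpret glm_KM n u P k L KM \<gamma> \<theta> \<delta>' N
    proof unfold_locales
      fix B Q assume "B \<in> {1, k}" "L2 n Q \<le> B"
      moreover from this have "0 < B" using pos by auto
      ultimately show
        "measure_pmf.prob (result Q (KM n B \<theta> \<delta>')) (- {Q'. recovers n \<gamma> \<theta> Q Q'}) \<le> \<delta>'"
        "terminates_in Q (KM n B \<theta> \<delta>') N {Q'. card (supp n Q') \<le> N}"
        using KM N_le \<theta> \<delta>' by simp_all
    qed (use u pos \<delta>' in auto)
    let ?prog = "kmtron KM n u k lr T \<theta> \<delta>' m"
    let ?good = "{(Fs, F). err n u P (best_iterate n u P Fs) \<le> \<epsilon> \<and> err n u P F \<le> \<epsilon>}"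
    have failure: "measure_pmf.prob (result target ?prog) (- ?good) \<le> \<delta>"
    \<comment> \<open>The analysis assumes \<open>\<epsilon> < 1\<close>; for larger
      \<open>\<epsilon>\<close> any output will do, since errors never exceed 1.\<close>
    proof (cases "1 \<le> \<epsilon>")
      case True
      then have "err n u P F \<le> \<epsilon>" for F using err_le_1[of F] by linarith
      then have "- ?good = {}" by auto
      then show ?thesis using pos by simp
    next
      case False
      have "measure_pmf.prob (result target ?prog) (- ?good) \<le>
          real T * (2 * \<delta>') + real T * (2 * exp (- 2 * real m * (\<epsilon> / 20)\<^sup>2))"
      proof (rule prob_kmtron_failure[OF \<gamma> \<theta>(1) pos(3) _ lr bounds(1,4)])
        show "2 * k\<^sup>2 * L\<^sup>2 / \<epsilon>\<^sup>2 \<le> real T" unfolding T by linarith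
      qed (use False \<theta> in \<open>auto simp: C'_def\<close>)
      also have "\<dots> \<le> \<delta>"
        unfolding \<delta>'_def using bounds(1) pos
        by (intro failure_budget) (auto simp: m)
      finally show ?thesis .
    qed
    have "{((Fs, F), t). err n u P (best_iterate n u P Fs) \<le> \<epsilon> \<and> err n u P F \<le> \<epsilon>} = fst -` ?good"
      by auto
    then have "measure_pmf.prob (run target ?prog)
        {((Fs, F), t). err n u P (best_iterate n u P Fs) \<le> \<epsilon> \<and> err n u P F \<le> \<epsilon>} =
      measure_pmf.prob (run target ?prog) (fst -` ?good)"
      by (rule arg_cong)
    also have "\<dots> = measure_pmf.prob (result target ?prog) ?good"
      by (simp only: result_def measure_map_pmf)
    also have "\<dots> \<ge> 1 - \<delta>"
      using failure measure_pmf.prob_compl[of ?good "result target ?prog"]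
      by (simp add: Compl_eq_Diff_UNIV)
    finally have success: "1 - \<delta> \<le> measure_pmf.prob (run target ?prog)
        {((Fs, F), t). err n u P (best_iterate n u P Fs) \<le> \<epsilon> \<and> err n u P F \<le> \<epsilon>}" .
    have time: "real t \<le> a0 * X ^ D" if "(v, t) \<in> set_pmf (run target ?prog)" for v t
    proof -
      have "t \<le> 12 * (n + 1) * (N + 1)\<^sup>2 * (T + 1) * (m + 1)"
        using terminates_in_kmtron[of lr T m] that unfolding terminates_in_def by blast
      then have "real t \<le> real (12 * (n + 1) * (N + 1)\<^sup>2 * (T + 1) * (m + 1))"
        by (rule of_nat_mono)
      also have "\<dots> \<le> a0 * X ^ D"
        unfolding a0_def D_def using X(1) A X(6) N bounds(2,5) by (rule kmtron_time_bound)
      finally show ?thesis .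
    qed
    \<comment> \<open>Used with \<open>Z = X\<close> for arbitrary \<open>\<theta>\<close> and with
      \<open>Z = Y\<close> for the extremal one. The exponent 11 is \<open>4 + 3 + 4\<close>, the
      degree of \<open>L ^ 4 * k ^ 3 / \<epsilon> ^ 4\<close>.\<close>
    have poly: "a0 * X ^ D \<le> a * Z ^ (11 * D)" if "0 \<le> Z" "X \<le> (1 + 1 / C') * Z ^ 11" for Z
    proof -
      have "X ^ D \<le> ((1 + 1 / C') * Z ^ 11) ^ D"
        using that X by (intro power_mono) auto
      then show ?thesis
        using a0 by (simp add: a_def power_mult_distrib power_mult mult.assoc mult_left_mono)
    qed
    have "1 * X \<le> (1 + 1 / C') * X ^ 11"
      using C' X(1) self_le_power[of X 11] by (intro mult_mono) auto
    then have poly_X: "a0 * X ^ D \<le> a * X ^ (11 * D)"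
      using X by (intro poly) auto
    have poly_Y: "a0 * X ^ D \<le> a * Y ^ (11 * D)" if "\<theta> = C' * \<epsilon> ^ 4 / (L ^ 4 * k ^ 3)"
    proof (rule poly)
      have "1 / \<theta> = 1 / C' * (L ^ 4 * k ^ 3 * (1 / \<epsilon>) ^ 4)"
        using that by (simp add: power_divide)
      also have "L ^ 4 * k ^ 3 * (1 / \<epsilon>) ^ 4 \<le> Y ^ 4 * Y ^ 3 * Y ^ 4"
        using Y pos by (intro mult_mono power_mono) auto
      also have "\<dots> = Y ^ 11" by (simp flip: power_add)
      finally have "1 / \<theta> \<le> 1 / C' * Y ^ 11"
        using C' by (simp add: mult_left_mono divide_right_mono)
      moreover have "Y \<le> Y ^ 11" using Y(1) by (intro self_le_power) auto
      ultimately show "X \<le> (1 + 1 / C') * Y ^ 11" by (simp add: X_def distrib_right)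
    qed (use Y in simp)
    have X_eq: "X = 1 + real n + k + L + 1 / \<epsilon> + 1 / \<theta> + ln (1 / \<delta>)"
      by (simp add: X_def Y_def)
    show "let out = run (\<lambda>x. u (P x)) (kmtron KM n u k lr T \<theta> (\<delta> / (4 * real T)) m) in
        measure_pmf.prob out
          {((Fs, F), t). err n u P (best_iterate n u P Fs) \<le> \<epsilon> \<and> err n u P F \<le> \<epsilon>} \<ge> 1 - \<delta> \<and>
        (\<forall>((Fs, F), t)\<in>set_pmf out.
           real t \<le> a * (1 + real n + k + L + 1/\<epsilon> + 1/\<theta> + ln (1/\<delta>)) ^ (11 * D)) \<and>
        (\<theta> = C' * \<epsilon>^4 / (L^4 * k^3) \<longrightarrow>
           (\<forall>((Fs, F), t)\<in>set_pmf out.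
              real t \<le> a * (1 + real n + k + L + 1/\<epsilon> + ln (1/\<delta>)) ^ (11 * D)))"
      unfolding Let_def \<delta>'_def[symmetric] X_eq[symmetric] Y_def[symmetric]
    proof (intro conjI impI success)
      show "\<forall>((Fs, F), t)\<in>set_pmf (run target ?prog). real t \<le> a * X ^ (11 * D)"
        using time poly_X by fastforce
      show "\<forall>((Fs, F), t)\<in>set_pmf (run target ?prog). real t \<le> a * Y ^ (11 * D)"
        if "\<theta> = C' * \<epsilon> ^ 4 / (L ^ 4 * k ^ 3)"
        using time poly_Y[OF that] by fastforce
    qed
  qed
qed

end
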